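(* Let $k$ be a field of positive characteristic, let $p$ be a prime number, let $G$ be a $p$-adic analytic group, and let $V$ be a smooth representation of $G$ on a $k$-vector space. Then $\mathbf{R}^1(\,\cdot\,)^{\mathrm{sm}}(V)=\{0\}$, where $\mathbf{R}^1(\,\cdot\,)^{\mathrm{sm}}$ is the first right derived functor of the smooth part functor $(\,\cdot\,)^{\mathrm{sm}}\colon \mathrm{Rep}_k(G)\to\mathrm{Rep}_k^{\mathrm{sm}}(G)$.
   Context: A $p$-adic analytic group is a topological group carrying the structure of a $p$-adic analytic manifold over $\mathbb{Q}_p$ with analytic group operations; equivalently, a topological group containing an open subgroup that is a finitely generated powerful pro-$p$ group. (A pro-$p$ group $U$ is powerful if $p$ is odd and $U/\overline{U^p}$ is abelian, or $p=2$ and $U/\overline{U^4}$ is abelian, where $U^n$ is the subgroup generated by the $n$-th powers and the bar denotes topological closure.) $G$ is not assumed compact, and $p$ need not be the characteristic of $k$. $\mathrm{Rep}_k(G)$ is the category of all $k$-linear representations of the abstract group $G$ on $k$-vector spaces. A representation $V$ is smooth if the action map $G\times V\to V$ is continuous when $V$ has the discrete topology; equivalently, the stabilizer of every vector is open. $\mathrm{Rep}_k^{\mathrm{sm}}(G)$ is the full subcategory of $\mathrm{Rep}_k(G)$ consisting of smooth representations. For $V\in\mathrm{Rep}_k(G)$, the smooth part is $V^{\mathrm{sm}}=\bigcup_{K} V^K$, where $K$ runs through the compact open subgroups of $G$ and $V^K=\{v\in V\mid xv=v \text{ for all } x\in K\}$; it is the largest smooth subrepresentation of $V$. This defines a left exact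 functor $(\,\cdot\,)^{\mathrm{sm}}\colon\mathrm{Rep}_k(G)\to\mathrm{Rep}_k^{\mathrm{sm}}(G)$, with right derived functors $\mathbf{R}^i(\,\cdot\,)^{\mathrm{sm}}$, $i\ge 0$, defined using injective resolutions in $\mathrm{Rep}_k(G)$. The underlying $k$-vector space of $\mathbf{R}^i(\,\cdot\,)^{\mathrm{sm}}(V)$ is $\varinjlim_{K} H^i_{\mathrm{abs}}(K,V)$, where $K$ runs through the compact open subgroups of $G$, the transition maps are restriction, and $H^i_{\mathrm{abs}}$ denotes cohomology of abstract groups. *)

theory Defs
  imports
    "HOL-Analysis.Analysis"
    "HOL-Algebra.Module"
    "HOL-Algebra.AbelCoset"
    "HOL-Algebra.Generated_Groups"
begin

section \<open>\<open>p\<close>-adic analytic groups\<close>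

locale topological_group = group G for G :: "'g monoid" (structure) +
  fixes T :: "'g topology"
  assumes topspace_eq: "topspace T = carrier G"
    and continuous_mult: "continuous_map (prod_topology T T) T (\<lambda>(x, y). x \<otimes> y)"
    and continuous_inv: "continuous_map T T (\<lambda>x. inv x)"

definition profinite_group :: "'g monoid \<Rightarrow> 'g topology \<Rightarrow> bool" where
  "profinite_group G T \<longleftrightarrow>
     topological_group G T \<and> compact_space T \<and> Hausdorff_space T \<and>
     (\<forall>W. openin T W \<and> \<one>\<^bsub>G\<^esub> \<in> W \<longrightarrow> (\<exists>H. subgroup H G \<and> openin T H \<and> H \<subseteq> W))"

text \<open>Cosets of an open subgroup of a compact group are finite in number, so the
  cardinality below is the genuine index; in any case \<open>card\<close> of an infinite set is
  \<open>0\<close>, which is not a power of a prime.\<close>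

definition pro_p_group :: "nat \<Rightarrow> 'g monoid \<Rightarrow> 'g topology \<Rightarrow> bool" where
  "pro_p_group p G T \<longleftrightarrow>
     profinite_group G T \<and>
     (\<forall>N. N \<lhd> G \<and> openin T N \<longrightarrow> (\<exists>m. card (rcosets\<^bsub>G\<^esub> N) = p ^ m))"

definition power_subgroup :: "'g monoid \<Rightarrow> nat \<Rightarrow> 'g set" where
  "power_subgroup G n = generate G ((\<lambda>x. x [^]\<^bsub>G\<^esub> n) ` carrier G)"

definition powerful_pro_p_group :: "nat \<Rightarrow> 'g monoid \<Rightarrow> 'g topology \<Rightarrow> bool" where
  "powerful_pro_p_group p G T \<longleftrightarrow>
     pro_p_group p G T \<and>
     comm_group (G Mod (T closure_of power_subgroup G (if p = 2 then 4 else p)))"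

text \<open>As usual for profinite groups, finite generation is meant topologically.\<close>

definition topologically_finitely_generated :: "'g monoid \<Rightarrow> 'g topology \<Rightarrow> bool" where
  "topologically_finitely_generated G T \<longleftrightarrow>
     (\<exists>S. finite S \<and> S \<subseteq> carrier G \<and> T closure_of (generate G S) = carrier G)"

text \<open>The group-theoretic description of \<open>p\<close>-adic analytic groups (Lazard): there is an
  open subgroup which is a finitely generated powerful pro-\<open>p\<close> group.\<close>

definition p_adic_analytic_group :: "nat \<Rightarrow> 'g monoid \<Rightarrow> 'g topology \<Rightarrow> bool" where
  "p_adic_analytic_group p G T \<longleftrightarrow>
     topological_group G T \<and>
     (\<exists>U. subgroup U G \<and> openin T U \<and>
        powerful_pro_p_group p (G\<lparr>carrier := U\<rparr>) (subtopology T U) \<and>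
        topologically_finitely_generated (G\<lparr>carrier := U\<rparr>) (subtopology T U))"


section \<open>The category of \<open>K\<close>-linear representations of an abstract group\<close>

text \<open>A \<open>K\<close>-module together with a group action on it. The ring fields \<open>mult\<close> and
  \<open>one\<close> inherited from the \<open>module\<close> record play no role.\<close>

record ('k, 'v, 'g) repn = "('k, 'v) module" +
  act :: "'g \<Rightarrow> 'v \<Rightarrow> 'v"

locale representation =
  G?: group G + K?: field K + V?: module K V
  for G :: "'g monoid" and K :: "'k ring" and V :: "('k, 'v, 'g) repn" +
  assumes act_closed: "\<lbrakk>g \<in> carrier G; v \<in> carrier V\<rbrakk> \<Longrightarrow> act V g v \<in> carrier V"
    and act_add: "\<lbrakk>g \<in> carrier G; v \<in> carrier V; w \<in> carrier V\<rbrakk> \<Longrightarrow>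
      act V g (v \<oplus>\<^bsub>V\<^esub> w) = act V g v \<oplus>\<^bsub>V\<^esub> act V g w"
    and act_smult: "\<lbrakk>g \<in> carrier G; a \<in> carrier K; v \<in> carrier V\<rbrakk> \<Longrightarrow>
      act V g (a \<odot>\<^bsub>V\<^esub> v) = a \<odot>\<^bsub>V\<^esub> act V g v"
    and act_one: "v \<in> carrier V \<Longrightarrow> act V \<one>\<^bsub>G\<^esub> v = v"
    and act_mult: "\<lbrakk>g \<in> carrier G; h \<in> carrier G; v \<in> carrier V\<rbrakk> \<Longrightarrow>
      act V (g \<otimes>\<^bsub>G\<^esub> h) v = act V g (act V h v)"

definition rep_hom ::
  "'g monoid \<Rightarrow> 'k ring \<Rightarrow> ('k, 'v, 'g) repn \<Rightarrow> ('k, 'w, 'g) repn \<Rightarrow> ('v \<Rightarrow> 'w) set" where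
  "rep_hom G K V W =
     {f \<in> carrier V \<rightarrow> carrier W.
        (\<forall>v\<in>carrier V. \<forall>w\<in>carrier V. f (v \<oplus>\<^bsub>V\<^esub> w) = f v \<oplus>\<^bsub>W\<^esub> f w) \<and>
        (\<forall>a\<in>carrier K. \<forall>v\<in>carrier V. f (a \<odot>\<^bsub>V\<^esub> v) = a \<odot>\<^bsub>W\<^esub> f v) \<and>
        (\<forall>g\<in>carrier G. \<forall>v\<in>carrier V. f (act V g v) = act W g (f v))}"

text \<open>Injective objects. A HOL formula cannot quantify over all types, so the test objects
  \<open>A\<close> and \<open>B\<close> have their carriers in the fixed type \<^typ>\<open>'g \<Rightarrow> 'k\<close>. This type contains the
  group algebra \<open>K[G]\<close> (the finitely supported functions) and all its left ideals, so by
  Baer's criterion the extension property for these test objects implies the extension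
  property for test objects of arbitrary type. No generality is lost, and the property does
  not depend on the type \<^typ>\<open>'i\<close> in which the injective object itself lives.\<close>

definition injective_rep :: "'g monoid \<Rightarrow> 'k ring \<Rightarrow> ('k, 'i, 'g) repn \<Rightarrow> bool" where
  "injective_rep G K J \<longleftrightarrow>
     representation G K J \<and>
     (\<forall>(A :: ('k, 'g \<Rightarrow> 'k, 'g) repn) (B :: ('k, 'g \<Rightarrow> 'k, 'g) repn) \<iota> f.
        representation G K A \<and> representation G K B \<and>
        \<iota> \<in> rep_hom G K A B \<and> inj_on \<iota> (carrier A) \<and> f \<in> rep_hom G K A J
        \<longrightarrow> (\<exists>h \<in> rep_hom G K B J. \<forall>a\<in>carrier A. h (\<iota> a) = f a))"

text \<open>\<open>0 \<rightarrow> V \<rightarrow> I 0 \<rightarrow> I 1 \<rightarrow> \<dots>\<close> exact with augmentation \<open>\<epsilon>\<close>, differentials \<open>d n\<close> and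
  injective \<open>I n\<close>.\<close>

definition injective_resolution ::
  "'g monoid \<Rightarrow> 'k ring \<Rightarrow> ('k, 'v, 'g) repn \<Rightarrow> ('v \<Rightarrow> 'i) \<Rightarrow>
   (nat \<Rightarrow> ('k, 'i, 'g) repn) \<Rightarrow> (nat \<Rightarrow> 'i \<Rightarrow> 'i) \<Rightarrow> bool" where
  "injective_resolution G K V \<epsilon> I d \<longleftrightarrow>
     representation G K V \<and>
     (\<forall>n. injective_rep G K (I n)) \<and>
     \<epsilon> \<in> rep_hom G K V (I 0) \<and>
     (\<forall>n. d n \<in> rep_hom G K (I n) (I (Suc n))) \<and>
     inj_on \<epsilon> (carrier V) \<and>
     \<epsilon> ` carrier V = {x \<in> carrier (I 0). d 0 x = \<zero>\<^bsub>I 1\<^esub>} \<and>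
     (\<forall>n. d n ` carrier (I n) = {x \<in> carrier (I (Suc n)). d (Suc n) x = \<zero>\<^bsub>I (Suc (Suc n))\<^esub>})"


section \<open>Cohomology of complexes of representations\<close>

text \<open>The quotient of \<open>V\<close> by a subrepresentation with carrier \<open>W\<close>. Adding \<open>W\<close> in \<open>smult\<close>
  is needed for multiplication by zero to yield the coset \<open>W\<close> and not just \<open>{\<zero>}\<close>.\<close>

definition quotient_rep ::
  "('k, 'v, 'g) repn \<Rightarrow> 'v set \<Rightarrow> ('k, 'v set, 'g) repn" where
  "quotient_rep V W =
     \<lparr>carrier = a_rcosets\<^bsub>V\<^esub> W, mult = undefined, one = undefined,
      zero = W, add = (\<lambda>X Y. X <+>\<^bsub>V\<^esub> Y),
      smult = (\<lambda>a X. W <+>\<^bsub>V\<^esub> ((\<lambda>x. a \<odot>\<^bsub>V\<^esub> x) ` X)),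
      act = (\<lambda>g X. act V g ` X)\<rparr>"

definition cocycles ::
  "(nat \<Rightarrow> ('k, 'v, 'g) repn) \<Rightarrow> (nat \<Rightarrow> 'v \<Rightarrow> 'v) \<Rightarrow> nat \<Rightarrow> 'v set" where
  "cocycles C d n = {x \<in> carrier (C n). d n x = \<zero>\<^bsub>C (Suc n)\<^esub>}"

definition coboundaries ::
  "(nat \<Rightarrow> ('k, 'v, 'g) repn) \<Rightarrow> (nat \<Rightarrow> 'v \<Rightarrow> 'v) \<Rightarrow> nat \<Rightarrow> 'v set" where
  "coboundaries C d n = (case n of 0 \<Rightarrow> {\<zero>\<^bsub>C 0\<^esub>} | Suc m \<Rightarrow> d m ` carrier (C m))"

definition cohomology ::
  "(nat \<Rightarrow> ('k, 'v, 'g) repn) \<Rightarrow> (nat \<Rightarrow> 'v \<Rightarrow> 'v) \<Rightarrow> nat \<Rightarrow> ('k, 'v set, 'g) repn" where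
  "cohomology C d n = quotient_rep ((C n)\<lparr>carrier := cocycles C d n\<rparr>) (coboundaries C d n)"


section \<open>Smooth representations and the derived functors of the smooth part\<close>

definition smooth_representation ::
  "'g monoid \<Rightarrow> 'g topology \<Rightarrow> 'k ring \<Rightarrow> ('k, 'v, 'g) repn \<Rightarrow> bool" where
  "smooth_representation G T K V \<longleftrightarrow>
     representation G K V \<and>
     continuous_map (prod_topology T (discrete_topology (carrier V)))
       (discrete_topology (carrier V)) (\<lambda>(g, v). act V g v)"

definition fixed_vectors :: "('k, 'v, 'g) repn \<Rightarrow> 'g set \<Rightarrow> 'v set" where
  "fixed_vectors V H = {v \<in> carrier V. \<forall>x\<in>H. act V x v = v}"

definition smooth_part ::
  "'g monoid \<Rightarrow> 'g topology \<Rightarrow> ('k, 'v, 'g) repn \<Rightarrow> ('k, 'v, 'g) repn" where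
  "smooth_part G T V =
     V\<lparr>carrier := \<Union>{fixed_vectors V H | H. subgroup H G \<and> compactin T H \<and> openin T H}\<rparr>"

text \<open>The value at \<open>V\<close> of the \<open>n\<close>-th right derived functor of the smooth part, computed
  from an injective resolution \<open>(I, d)\<close> of \<open>V\<close>. On morphisms the smooth part functor is
  restriction, hence the differentials are again given by \<open>d\<close>.\<close>

definition derived_smooth_part ::
  "'g monoid \<Rightarrow> 'g topology \<Rightarrow> (nat \<Rightarrow> ('k, 'i, 'g) repn) \<Rightarrow> (nat \<Rightarrow> 'i \<Rightarrow> 'i) \<Rightarrow>
   nat \<Rightarrow> ('k, 'i set, 'g) repn" where
  "derived_smooth_part G T I d n = cohomology (\<lambda>m. smooth_part G T (I m)) d n"

end

theory Submission
  imports Defs "HOL-Algebra.Group_Action" "HOL-Algebra.Multiplicative_Group"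
begin

text \<open>
  A \<open>1\<close>-cocycle of the complex of smooth parts is a smooth vector \<open>x\<close> of \<open>I 1\<close> with \<open>d 1 x = 0\<close>. By
  exactness \<open>x = d 0 y\<close> with \<open>y\<close> in \<open>I 0\<close>. If \<open>x\<close> is fixed by an open subgroup \<open>H\<close>, then \<open>d 0\<close> kills
  \<open>gy - y\<close> for every \<open>g\<close> in \<open>H\<close>. So \<open>gy - y\<close> lies in the image of \<open>V\<close>, and since \<open>V\<close> is smooth
  its stabilizer is open. The map sending \<open>g\<close> to \<open>gy - y\<close> is a cocycle of the abstract group \<open>H\<close>,
  a priori without any continuity, and no open subgroup need stabilize all its values. Nevertheless \<open>y\<close> itself
  is smooth (lemma \<open>smooth_of_smooth_differences\<close>), so \<open>x\<close> is a coboundary of smooth vectors.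

  \<^emph>\<open>Procyclic subgroups\<close> (\<open>procyclic_stabilizes\<close>). Let \<open>l > 0\<close> be zero in \<open>K\<close>. If \<open>z\<close> fixes
  \<open>w = zy - y\<close>, then \<open>z\<^sup>n y = y + n w\<close>, so \<open>z\<^sup>l\<close> fixes \<open>y\<close>. Every element has a power \<open>z\<close> like this:
  after replacing \<open>x\<close> by a power in \<open>H\<close>, some \<open>x\<^sup>r\<close> with \<open>r > 0\<close> fixes \<open>xy - y\<close>, which says
  \<open>x\<^sup>r\<^sup>+\<^sup>1 y - x\<^sup>r y = xy - y\<close>, which in turn says that \<open>x\<close> fixes \<open>x\<^sup>r y - y\<close>. Hence some power \<open>s\<close>
  of \<open>x\<close> fixes \<open>y\<close>. Let \<open>B\<close> be the closed subgroup generated by \<open>s\<close>. It is commutative, so \<open>s\<close> fixes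
  \<open>by - y\<close> for each \<open>b\<close> in \<open>B\<close>. The stabilizer of \<open>by - y\<close> is open, hence closed, hence it
  contains \<open>B\<close>, and in particular \<open>b\<close>. By the first remark \<open>b\<^sup>l\<close> fixes \<open>y\<close>. Thus \<open>y\<close> is fixed by the
  closed subgroup that a power of \<open>x\<close> generates, and not merely by the powers themselves.

  \<^emph>\<open>From procyclic subgroups to an open one\<close> (\<open>subgroup_contains_F\<close>). Let \<open>U\<close> be a powerful pro-\<open>p\<close>
  group topologically generated by \<open>x\<^sub>1, \<dots>, x\<^sub>d\<close>, and let the stabilizer contain the closed subgroups
  generated by the \<open>N\<close>-th powers of the \<open>x\<^sub>i\<close>. In a pro-\<open>p\<close> group the part of \<open>N\<close> prime to \<open>p\<close> can be
  discarded, so let \<open>N = p\<^sup>n\<close>. Let \<open>F m\<close> be the lower \<open>p\<close>-series, starting with \<open>F 0 = U\<close>. Powerfulness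
  makes the \<open>p\<close>-th power map induce homomorphisms \<open>F m / F (m + 1) \<rightarrow> F (m + 1) / F (m + 2)\<close>
  (\<open>pow_mult_mod\<close>), and they are surjective (\<open>F_Suc_subset_pow_image\<close>). Therefore \<open>F m / F (m + 1)\<close>
  is generated by the \<open>p\<^sup>m\<close>-th powers of the \<open>x\<^sub>i\<close>, so it is finite and \<open>F m\<close> is open. Successive
  approximation and compactness show that \<open>F n\<close> is contained in the product of the closed subgroups
  generated by the \<open>p\<^sup>n\<close>-th powers of the \<open>x\<^sub>i\<close> (\<open>F_subset_procyclic_product\<close>). The product being a
  plain product of sets, an abstract subgroup that contains its factors contains \<open>F n\<close>.
\<close>

section \<open>Commutators and computations modulo a normal subgroup\<close>

definition (in group) commutator :: "'a \<Rightarrow> 'a \<Rightarrow> 'a" where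
  "commutator x y = inv x \<otimes> inv y \<otimes> x \<otimes> y"

lemma (in group) commutator_closed [simp, intro]:
  "x \<in> carrier G \<Longrightarrow> y \<in> carrier G \<Longrightarrow> commutator x y \<in> carrier G"
  by (simp add: commutator_def)

lemma (in group) mult_commutator:
  assumes "x \<in> carrier G" "y \<in> carrier G"
  shows "y \<otimes> x \<otimes> commutator x y = x \<otimes> y"
proof -
  have "commutator x y = inv (y \<otimes> x) \<otimes> (x \<otimes> y)"
    using assms by (simp add: commutator_def inv_mult_group m_assoc)
  then show ?thesis
    using assms by (simp add: m_assoc[symmetric]) 
qed

lemma (in group) commute_nat_pow:
  assumes "x \<in> carrier G" "y \<in> carrier G" "x \<otimes> y = y \<otimes> x"
  shows "x [^] (n::nat) \<otimes> y = y \<otimes> x [^] n"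
proof (induction n)
  case (Suc n)
  have "x [^] Suc n \<otimes> y = x [^] n \<otimes> (y \<otimes> x)"
    using assms by (simp add: m_assoc)
  also have "\<dots> = y \<otimes> x [^] Suc n"
    using assms Suc by (simp flip: m_assoc)
  finally show ?case .
qed (use assms in simp)

text \<open>The commutator \<open>u\<close> is central in the group generated by \<open>b\<close> and \<open>c\<close>. Sorting \<open>(bc)\<^sup>n\<close> moves a letter \<open>c\<close> past a
  letter \<open>b\<close> once for each of the \<open>n (n - 1) / 2\<close> pairs, and each move costs one factor \<open>u\<close>.\<close>
lemma (in group) mult_pow_commutator:
  assumes [simp]: "b \<in> carrier G" "c \<in> carrier G" "u \<in> carrier G"
    and cb: "c \<otimes> b = b \<otimes> c \<otimes> u"
    and ub: "u \<otimes> b = b \<otimes> u" and uc: "u \<otimes> c = c \<otimes> u"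
  shows "(b \<otimes> c) [^] (n::nat) = b [^] n \<otimes> c [^] n \<otimes> u [^] (n * (n - 1) div 2)"
proof (induction n)
  case (Suc n)
  have push: "x [^] (k::nat) \<otimes> (y \<otimes> z) = y \<otimes> (x [^] k \<otimes> z)"
    if "x \<otimes> y = y \<otimes> x" "x \<in> carrier G" "y \<in> carrier G" "z \<in> carrier G" for x y z k
    using that commute_nat_pow[of x y k] by (metis m_assoc nat_pow_closed)
  have un: "u [^] (k::nat) \<otimes> b = b \<otimes> u [^] k" "u [^] k \<otimes> c = c \<otimes> u [^] k" for k
    using commute_nat_pow ub uc by auto
  have cnb: "c [^] (n::nat) \<otimes> b = b \<otimes> (c [^] n \<otimes> u [^] n)" for n
  proof (induction n)
    case (Suc n)
    have "c [^] Suc n \<otimes> b = (c [^] n \<otimes> b) \<otimes> (c \<otimes> u)"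
      by (simp add: m_assoc cb)
    also have "\<dots> = b \<otimes> c [^] n \<otimes> (u [^] n \<otimes> (c \<otimes> u))"
      by (simp add: Suc m_assoc)
    also have "\<dots> = b \<otimes> c [^] Suc n \<otimes> u [^] Suc n"
      by (simp add: push uc m_assoc)
    finally show ?case by (simp add: m_assoc)
  qed simp
  let ?k = "n * (n - 1) div 2"
  have k: "Suc n * (Suc n - 1) div 2 = n + ?k"
    by (cases n) (auto simp: algebra_simps)
  have "(b \<otimes> c) [^] Suc n = b [^] n \<otimes> (c [^] n \<otimes> (u [^] ?k \<otimes> (b \<otimes> c)))"
    by (simp add: Suc m_assoc)
  also have "u [^] ?k \<otimes> (b \<otimes> c) = b \<otimes> (c \<otimes> u [^] ?k)"
    by (simp add: push ub un)
  also have "c [^] n \<otimes> (b \<otimes> (c \<otimes> u [^] ?k)) = (c [^] n \<otimes> b) \<otimes> (c \<otimes> u [^] ?k)"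
    by (simp add: m_assoc)
  also have "\<dots> = b \<otimes> (c [^] n \<otimes> (c \<otimes> (u [^] n \<otimes> u [^] ?k)))"
    by (simp add: cnb m_assoc push uc)
  also have "u [^] n \<otimes> u [^] ?k = u [^] (n + ?k)"
    by (simp add: nat_pow_mult)
  finally show ?case unfolding k by (simp add: m_assoc)
qed simp

lemma (in normal) coset_pow:
  "a \<in> carrier G \<Longrightarrow> H #> (a [^] (k::nat)) = (H #> a) [^]\<^bsub>G Mod H\<^esub> k"
  by (simp add: FactGroup_pow)

lemma (in normal) coset_mult:
  "x \<in> carrier G \<Longrightarrow> y \<in> carrier G \<Longrightarrow> H #> (x \<otimes> y) = (H #> x) \<otimes>\<^bsub>G Mod H\<^esub> (H #> y)"
  by (simp add: rcos_sum)

lemma (in normal) coset_carrier: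
  "x \<in> carrier G \<Longrightarrow> H #> x \<in> carrier (G Mod H)"
  by (simp add: carrier_FactGroup)

lemma (in normal) coset_of_mem [simp]: "x \<in> H \<Longrightarrow> H #> x = H"
  by (meson coset_join2 mem_carrier is_subgroup)

lemma (in normal) coset_eq_iff:
  assumes "x \<in> carrier G" "y \<in> carrier G"
  shows "H #> x = H #> y \<longleftrightarrow> (\<exists>h\<in>H. x = y \<otimes> h)"
proof -
  have "H #> x = H #> y \<longleftrightarrow> x \<in> H #> y"
    using assms repr_independence[OF _ _ is_subgroup] rcos_self[OF _ is_subgroup] by metis
  also have "x \<in> H #> y \<longleftrightarrow> x \<in> y <# H" using coset_eq assms by auto
  also have "x \<in> y <# H \<longleftrightarrow> (\<exists>h\<in>H. x = y \<otimes> h)" by (auto simp: l_coset_def)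
  finally show ?thesis .
qed

lemma (in normal) coset_commute_iff:
  assumes "x \<in> carrier G" "y \<in> carrier G"
  shows "H #> (x \<otimes> y) = H #> (y \<otimes> x) \<longleftrightarrow> commutator x y \<in> H"
proof -
  have "H #> (x \<otimes> y) = H #> (y \<otimes> x) \<longleftrightarrow> (\<exists>h\<in>H. y \<otimes> x \<otimes> commutator x y = y \<otimes> x \<otimes> h)"
    using assms by (subst coset_eq_iff) (auto simp: mult_commutator)
  also have "\<dots> \<longleftrightarrow> commutator x y \<in> H"
    using assms by auto
  finally show ?thesis .
qed

text \<open>The power map is additive on \<open>b\<close> and \<open>c\<close> modulo \<open>H\<close> as soon as their commutator is central
  modulo \<open>H\<close> and killed by the binomial exponent.\<close>
lemma (in normal) coset_mult_pow:
  assumes bc: "b \<in> carrier G" "c \<in> carrier G"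
    and u: "\<And>g. g \<in> carrier G \<Longrightarrow> commutator (commutator c b) g \<in> H"
    and pow: "commutator c b [^] ((n::nat) * (n - 1) div 2) \<in> H"
  shows "H #> ((b \<otimes> c) [^] n) = H #> (b [^] n \<otimes> c [^] n)"
proof -
  interpret Q: group "G Mod H" by (rule factorgroup_is_group)
  let ?\<phi> = "\<lambda>x. H #> x" and ?u = "commutator c b"
  have comm: "?\<phi> ?u \<otimes>\<^bsub>G Mod H\<^esub> ?\<phi> g = ?\<phi> g \<otimes>\<^bsub>G Mod H\<^esub> ?\<phi> ?u" if "g \<in> carrier G" for g
    using u[OF that] bc that by (simp add: coset_commute_iff del: mult_FactGroup flip: coset_mult)
  have "?\<phi> c \<otimes>\<^bsub>G Mod H\<^esub> ?\<phi> b = ?\<phi> b \<otimes>\<^bsub>G Mod H\<^esub> ?\<phi> c \<otimes>\<^bsub>G Mod H\<^esub> ?\<phi> ?u"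
    using bc by (simp add: mult_commutator del: mult_FactGroup flip: coset_mult)
  from Q.mult_pow_commutator[OF _ _ _ this comm comm, of n] bc
  have "H #> ((b \<otimes> c) [^] n)
      = H #> (b [^] n \<otimes> c [^] n \<otimes> ?u [^] (n * (n - 1) div 2))"
    by (simp add: coset_mult coset_pow coset_carrier del: mult_FactGroup)
  also have "\<dots> = H #> (b [^] n \<otimes> c [^] n)"
    using bc pow by (subst coset_eq_iff) auto
  finally show ?thesis .
qed

lemma (in group) inv_cancel_left:
  "x \<in> carrier G \<Longrightarrow> z \<in> carrier G \<Longrightarrow> inv x \<otimes> (x \<otimes> z) = z"
  by (simp flip: m_assoc)

text \<open>Here \<open>b \<otimes> commutator b g\<close> is the conjugate \<open>g\<^sup>-\<^sup>1 b g\<close>, and conjugation commutes with powers.\<close>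
lemma (in group) conj_pow_commutator:
  assumes "b \<in> carrier G" "g \<in> carrier G"
  shows "g \<otimes> (b \<otimes> commutator b g) [^] (n::nat) = b [^] n \<otimes> g"
proof (induction n)
  case (Suc n)
  have "g \<otimes> (b \<otimes> commutator b g) [^] Suc n = b [^] n \<otimes> (g \<otimes> b \<otimes> commutator b g)"
    using assms Suc by (simp add: m_assoc[symmetric])
  also have "\<dots> = b [^] Suc n \<otimes> g"
    using assms by (subst mult_commutator) (simp_all add: m_assoc)
  finally show ?case .
qed (use assms in simp)

lemma (in group) subgroup_nat_pow_closed:
  assumes "subgroup H G" "h \<in> H"
  shows "h [^] (n::nat) \<in> H"
  using subgroup.m_closed[OF assms(1)] subgroup.one_closed[OF assms(1)] assms(2)
  by (induction n) auto

lemma (in normal) coset_mult_commute_iff: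
  assumes "x \<in> carrier G" "y \<in> carrier G"
  shows "(H #> x) \<otimes>\<^bsub>G Mod H\<^esub> (H #> y) = (H #> y) \<otimes>\<^bsub>G Mod H\<^esub> (H #> x) \<longleftrightarrow> commutator x y \<in> H"
  using coset_commute_iff[OF assms] coset_mult assms by metis

lemma (in normal) centralizer_mod_subgroup:
  "subgroup {h \<in> carrier G. \<forall>g\<in>carrier G. commutator h g \<in> H} G"
proof (rule subgroupI)
  interpret Q: group "G Mod H" by (rule factorgroup_is_group)
  let ?Z = "{h \<in> carrier G. \<forall>g\<in>carrier G. commutator h g \<in> H}"
  have Z_iff: "h \<in> ?Z \<longleftrightarrow> h \<in> carrier G \<and>
    (\<forall>g\<in>carrier G. (H #> h) \<otimes>\<^bsub>G Mod H\<^esub> (H #> g) = (H #> g) \<otimes>\<^bsub>G Mod H\<^esub> (H #> h))" for h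
    using coset_mult_commute_iff by blast
  show "?Z \<subseteq> carrier G" by auto
  have "commutator \<one> g \<in> H" if "g \<in> carrier G" for g
    using that by (simp add: commutator_def)
  then show "?Z \<noteq> {}" by blast
  fix a assume a: "a \<in> ?Z"
  show "inv a \<in> ?Z"
    unfolding Z_iff
  proof (intro conjI ballI)
    show ac: "inv a \<in> carrier G" using a by auto
    fix g assume g: "g \<in> carrier G"
    have *: "(H #> a) \<otimes>\<^bsub>G Mod H\<^esub> (H #> g) = (H #> g) \<otimes>\<^bsub>G Mod H\<^esub> (H #> a)"
      using a g unfolding Z_iff by blast
    have i: "H #> inv a = inv\<^bsub>G Mod H\<^esub> (H #> a)"
      using a by (simp add: inv_FactGroup coset_carrier rcos_inv)
    show "(H #> inv a) \<otimes>\<^bsub>G Mod H\<^esub> (H #> g) = (H #> g) \<otimes>\<^bsub>G Mod H\<^esub> (H #> inv a)"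
      unfolding i using a g *
      by (metis (no_types, lifting) Q.inv_closed Q.inv_solve_left Q.inv_solve_right Q.m_assoc
          Q.m_closed coset_carrier mem_Collect_eq)
  qed
  fix b assume b: "b \<in> ?Z"
  show "a \<otimes> b \<in> ?Z"
    unfolding Z_iff
  proof (intro conjI ballI)
    show "a \<otimes> b \<in> carrier G" using a b by auto
    fix g assume g: "g \<in> carrier G"
    have cl: "H #> a \<in> carrier (G Mod H)" "H #> b \<in> carrier (G Mod H)" "H #> g \<in> carrier (G Mod H)"
      using a b g coset_carrier by auto
    have "(H #> a) \<otimes>\<^bsub>G Mod H\<^esub> (H #> g) = (H #> g) \<otimes>\<^bsub>G Mod H\<^esub> (H #> a)"
      "(H #> b) \<otimes>\<^bsub>G Mod H\<^esub> (H #> g) = (H #> g) \<otimes>\<^bsub>G Mod H\<^esub> (H #> b)"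
      using a b g unfolding Z_iff by blast+
    then have "(H #> a) \<otimes>\<^bsub>G Mod H\<^esub> (H #> b) \<otimes>\<^bsub>G Mod H\<^esub> (H #> g)
        = (H #> g) \<otimes>\<^bsub>G Mod H\<^esub> ((H #> a) \<otimes>\<^bsub>G Mod H\<^esub> (H #> b))"
      using cl by (metis Q.m_assoc)
    then show "(H #> (a \<otimes> b)) \<otimes>\<^bsub>G Mod H\<^esub> (H #> g) = (H #> g) \<otimes>\<^bsub>G Mod H\<^esub> (H #> (a \<otimes> b))"
      using a b by (simp add: coset_mult del: mult_FactGroup)
  qed
qed

text \<open>The preimage of the \<open>n\<close>-torsion of the centre of the quotient.\<close>
lemma (in normal) central_torsion_mod_subgroup:
  "subgroup {h \<in> carrier G. h [^] (n::nat) \<in> H \<and> (\<forall>g\<in>carrier G. commutator h g \<in> H)} G"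
proof -
  let ?Z = "{h \<in> carrier G. \<forall>g\<in>carrier G. commutator h g \<in> H}"
  interpret Q: group "G Mod H" by (rule factorgroup_is_group)
  note Z = centralizer_mod_subgroup
  have pow: "a [^] n \<in> H \<longleftrightarrow> (H #> a) [^]\<^bsub>G Mod H\<^esub> n = \<one>\<^bsub>G Mod H\<^esub>" if "a \<in> carrier G" for a
    unfolding coset_pow[OF that, symmetric] one_FactGroup
    using coset_join1[OF _ _ is_subgroup] coset_of_mem that by blast
  show ?thesis
  proof (rule subgroupI)
    have "\<one> \<in> {h \<in> carrier G. h [^] n \<in> H \<and> (\<forall>g\<in>carrier G. commutator h g \<in> H)}"
      using subgroup.one_closed[OF Z] by simp
    then show "{h \<in> carrier G. h [^] n \<in> H \<and> (\<forall>g\<in>carrier G. commutator h g \<in> H)} \<noteq> {}"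
      by blast
    fix a assume a: "a \<in> {h \<in> carrier G. h [^] n \<in> H \<and> (\<forall>g\<in>carrier G. commutator h g \<in> H)}"
    then have "inv a \<in> ?Z" by (intro subgroup.m_inv_closed[OF Z]) auto
    moreover have "(inv a) [^] n \<in> H" using a nat_pow_inv[of a n] by auto
    ultimately show "inv a \<in> {h \<in> carrier G. h [^] n \<in> H \<and> (\<forall>g\<in>carrier G. commutator h g \<in> H)}"
      by auto
    fix b assume b: "b \<in> {h \<in> carrier G. h [^] n \<in> H \<and> (\<forall>g\<in>carrier G. commutator h g \<in> H)}"
    have "a \<otimes> b \<in> ?Z" using a b by (intro subgroup.m_closed[OF Z]) auto
    moreover have "(a \<otimes> b) [^] n \<in> H"
    proof -
      have "(H #> a) \<otimes>\<^bsub>G Mod H\<^esub> (H #> b) = (H #> b) \<otimes>\<^bsub>G Mod H\<^esub> (H #> a)"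
        using a b coset_mult_commute_iff by blast
      then have "((H #> a) \<otimes>\<^bsub>G Mod H\<^esub> (H #> b)) [^]\<^bsub>G Mod H\<^esub> n
          = (H #> a) [^]\<^bsub>G Mod H\<^esub> n \<otimes>\<^bsub>G Mod H\<^esub> (H #> b) [^]\<^bsub>G Mod H\<^esub> n"
        using a b coset_carrier by (intro Q.pow_mult_distrib) auto
      also have "\<dots> = \<one>\<^bsub>G Mod H\<^esub>"
        using a b pow by (metis (mono_tags, lifting) Q.l_one Q.one_closed mem_Collect_eq)
      finally show ?thesis using a b pow[of "a \<otimes> b"] by (simp add: coset_mult del: mult_FactGroup one_FactGroup)
    qed
    ultimately show "a \<otimes> b \<in> {h \<in> carrier G. h [^] n \<in> H \<and> (\<forall>g\<in>carrier G. commutator h g \<in> H)}"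
      by auto
  qed auto
qed

text \<open>Multiplication by \<open>M\<close> maps the cosets of \<open>N\<close> onto those of \<open>M\<close> and identifies the coset of an
  element of \<open>M - N\<close> with the trivial one.\<close>
lemma (in group) card_rcosets_less:
  assumes N: "subgroup N G" and M: "subgroup M G" and "N \<subset> M" and fin: "finite (rcosets N)"
  shows "card (rcosets M) < card (rcosets N)"
proof -
  obtain x where x: "x \<in> M" "x \<notin> N" using assms by blast
  have xc: "x \<in> carrier G" using x subgroup.mem_carrier[OF M] by blast
  have sub: "N \<subseteq> carrier G" "M \<subseteq> carrier G" using N M subgroup.subset by blast+
  have MN: "M <#> N = M"
  proof
    show "M <#> N \<subseteq> M" using assms subgroup.m_closed[OF M] by (auto simp: set_mult_def)
    show "M \<subseteq> M <#> N"
      using subgroup.one_closed[OF N] sub by (force simp: set_mult_def)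
  qed
  have img: "M <#> (N #> a) = M #> a" if "a \<in> carrier G" for a
    using setmult_rcos_assoc[OF sub(2) sub(1) that] MN by simp
  have eq: "rcosets M = (\<lambda>C. M <#> C) ` (rcosets N)"
    using img by (auto simp: RCOSETS_def image_iff)
  have "\<not> inj_on (\<lambda>C. M <#> C) (rcosets N)"
  proof
    assume inj: "inj_on (\<lambda>C. M <#> C) (rcosets N)"
    have "M <#> (N #> x) = M <#> (N #> \<one>)"
      using img[OF xc] img[OF one_closed] x(1) coset_join2[OF xc M] sub by simp
    then have "N #> x = N #> \<one>"
      using inj xc sub by (meson inj_onD one_closed rcosetsI)
    then show False using rcos_self[OF xc N] x sub by simp
  qed
  then show ?thesis
    using fin eq by (metis card_image_le eq_card_imp_inj_on le_neq_implies_less)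
qed

section \<open>A central element of order \<open>p\<close> in a finite \<open>p\<close>-group\<close>

text \<open>Class equation: the conjugacy classes have \<open>p\<close>-power size, the class of \<open>\<one>\<close> is a singleton, and the
  sizes add up to a multiple of \<open>p\<close>. So there is a second singleton class. A suitable power of its
  element has order \<open>p\<close>.\<close>
lemma (in group) p_group_central_element:
  assumes p: "Factorial_Ring.prime (p::nat)" and ord: "order G = p ^ m" and m: "m > 0"
  obtains z where "z \<in> carrier G" "z \<noteq> \<one>" "z [^] p = \<one>"
    "\<And>g. g \<in> carrier G \<Longrightarrow> g \<otimes> z = z \<otimes> g"
proof -
  define \<phi> where "\<phi> = (\<lambda>g. (\<lambda>h \<in> carrier G. g \<otimes> h \<otimes> inv g))"
  interpret A: group_action G "carrier G" \<phi>
    unfolding \<phi>_def by (rule action_by_conjugation)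
  have pp: "p > 1" "p > 0" using prime_gt_1_nat[OF p] by auto
  have fin: "finite (carrier G)"
    using ord pp order_gt_0_iff_finite by simp
  have fino: "finite (orbits G (carrier G) \<phi>)"
    by (simp add: orbits_def fin)
  have one: "orbit G \<phi> \<one> = {\<one>}"
    by (auto simp: orbit_def \<phi>_def intro!: exI[of _ \<one>])
  have "\<exists>x\<in>carrier G. x \<noteq> \<one> \<and> \<not> p dvd card (orbit G \<phi> x)"
  proof (rule ccontr)
    assume "\<not> ?thesis"
    then have *: "p dvd card X" if "X \<in> orbits G (carrier G) \<phi> - {{\<one>}}" for X
      using that one by (auto simp: orbits_def)
    have "order G = (\<Sum>x\<in>carrier G. 1)" by (simp add: order_def)
    also have "\<dots> = (\<Sum>X\<in>orbits G (carrier G) \<phi>. card X)"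
      using A.disjoint_sum[OF fin, of "\<lambda>_. 1::nat"] by simp
    also have "\<dots> = card {\<one>} + (\<Sum>X\<in>orbits G (carrier G) \<phi> - {{\<one>}}. card X)"
      using fino one by (subst sum.remove[of _ "{\<one>}"]) (auto simp: orbits_def)
    finally have "p ^ m = 1 + (\<Sum>X\<in>orbits G (carrier G) \<phi> - {{\<one>}}. card X)"
      using ord by simp
    moreover have "p dvd (\<Sum>X\<in>orbits G (carrier G) \<phi> - {{\<one>}}. card X)"
      by (rule dvd_sum) (use * in auto)
    moreover have "p dvd p ^ m" using m by simp
    ultimately have "p dvd 1" by (metis dvd_add_left_iff)
    then show False using pp by simp
  qed
  then obtain x where x: "x \<in> carrier G" "x \<noteq> \<one>" "\<not> p dvd card (orbit G \<phi> x)" by blast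
  have "card (orbit G \<phi> x) dvd p ^ m"
    using A.orbit_stabilizer_theorem[OF x(1)] ord by (metis dvd_triv_left)
  then obtain i where "card (orbit G \<phi> x) = p ^ i"
    using p by (auto simp: divides_primepow_nat)
  with x(3) have "card (orbit G \<phi> x) = 1" by (cases i) auto
  then obtain y where y: "orbit G \<phi> x = {y}" using card_1_singletonE by blast
  have conj: "g \<otimes> x \<otimes> inv g = x" if "g \<in> carrier G" for g
  proof -
    have "\<phi> g x \<in> orbit G \<phi> x" "x \<in> orbit G \<phi> x"
      using that A.orbit_refl[OF x(1)] unfolding orbit_def by blast+
    then have "\<phi> g x = x" unfolding y by (metis singletonD)
    with x(1) show ?thesis by (simp add: \<phi>_def)
  qed
  have cent: "x \<otimes> g = g \<otimes> x" if "g \<in> carrier G" for g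
    using conj[OF that] that x(1) by (metis inv_solve_right m_closed)
  have ex: "x [^] (p ^ m) = \<one>"
    using pow_order_eq_1[OF x(1)] ord by simp
  define j where "j = (LEAST j. x [^] (p ^ j) = \<one>)"
  have j: "x [^] (p ^ j) = \<one>" unfolding j_def by (rule LeastI) (rule ex)
  have "j \<noteq> 0" using j x by (auto intro: ccontr)
  then obtain i where i: "j = Suc i" by (cases j) auto
  have i': "x [^] (p ^ i) \<noteq> \<one>"
    using not_less_Least[of i "\<lambda>j. x [^] (p ^ j) = \<one>"] i j_def by auto
  show thesis
  proof (rule that[of "x [^] (p ^ i)"])
    show "(x [^] (p ^ i)) [^] p = \<one>"
      using j i x(1) by (simp add: nat_pow_pow mult.commute)
    show "g \<otimes> x [^] (p ^ i) = x [^] (p ^ i) \<otimes> g" if "g \<in> carrier G" for g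
      using commute_nat_pow[OF x(1) that cent[OF that]] by simp
  qed (use x i' in auto)
qed

section \<open>Ordered products of subsets\<close>

definition (in group) list_set_mult :: "('x \<Rightarrow> 'a set) \<Rightarrow> 'x list \<Rightarrow> 'a set" where
  "list_set_mult A xs = foldr (\<lambda>x S. A x <#> S) xs {\<one>}"

lemma (in group) list_set_mult_simps [simp]:
  "list_set_mult A [] = {\<one>}"
  "list_set_mult A (x # xs) = A x <#> list_set_mult A xs"
  by (simp_all add: list_set_mult_def)

lemma (in group) list_set_mult_carrier:
  assumes "\<And>x. x \<in> set xs \<Longrightarrow> A x \<subseteq> carrier G"
  shows "list_set_mult A xs \<subseteq> carrier G"
  using assms by (induction xs) (auto simp: set_mult_closed)

lemma (in group) list_set_mult_subgroup:
  assumes "subgroup S G" "\<And>x. x \<in> set xs \<Longrightarrow> A x \<subseteq> S"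
  shows "list_set_mult A xs \<subseteq> S"
  using assms(2)
proof (induction xs)
  case Nil then show ?case using subgroup.one_closed[OF assms(1)] by simp
next
  case (Cons x xs)
  then have "A x \<subseteq> S" "list_set_mult A xs \<subseteq> S" by auto
  then show ?case using subgroup.m_closed[OF assms(1)] by (auto simp: set_mult_def)
qed

lemma (in group) list_set_mult_finite:
  assumes "\<And>x. x \<in> set xs \<Longrightarrow> finite (A x)"
  shows "finite (list_set_mult A xs)"
  using assms by (induction xs) (auto simp: set_mult_def)

lemma (in group) list_set_mult_one:
  assumes "\<And>x. x \<in> set xs \<Longrightarrow> \<one> \<in> A x"
  shows "\<one> \<in> list_set_mult A xs"
  using assms
proof (induction xs)
  case (Cons x xs)
  then have "\<one> \<otimes> \<one> \<in> A x <#> list_set_mult A xs"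
    unfolding set_mult_def by force
  then show ?case by simp
qed simp

lemma (in group) list_set_mult_factor:
  assumes "x \<in> set xs" "y \<in> A x" "\<And>x. x \<in> set xs \<Longrightarrow> \<one> \<in> A x \<and> A x \<subseteq> carrier G"
  shows "y \<in> list_set_mult A xs"
  using assms
proof (induction xs)
  case (Cons a xs)
  have 1: "\<one> \<in> list_set_mult A xs" using Cons.prems(3) by (intro list_set_mult_one) auto
  have y: "y \<in> carrier G" using Cons.prems by blast
  show ?case
  proof (cases "y \<in> A a")
    case True
    with 1 have "y \<otimes> \<one> \<in> A a <#> list_set_mult A xs"
      unfolding set_mult_def by blast
    then show ?thesis using y by simp
  next
    case False
    with Cons have "y \<in> list_set_mult A xs" "\<one> \<in> A a" by auto
    then have "\<one> \<otimes> y \<in> A a <#> list_set_mult A xs"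
      unfolding set_mult_def by blast
    then show ?thesis using y by simp
  qed
qed simp

text \<open>Two ordered products are multiplied factor by factor when the factors of the second one are central modulo
  \<open>H\<close>. This lets finer and finer correction terms be absorbed into an ordered product of
  procyclic groups.\<close>
lemma (in normal) list_set_mult_absorb_central:
  assumes A: "\<And>x. x \<in> set xs \<Longrightarrow> A x \<subseteq> carrier G"
    and B: "\<And>x. x \<in> set xs \<Longrightarrow> B x \<subseteq> carrier G"
    and C: "\<And>x. x \<in> set xs \<Longrightarrow> C x \<subseteq> carrier G"
    and central: "\<And>x b g. x \<in> set xs \<Longrightarrow> b \<in> B x \<Longrightarrow> g \<in> carrier G \<Longrightarrow> commutator b g \<in> H"
    and AB: "\<And>x a b. x \<in> set xs \<Longrightarrow> a \<in> A x \<Longrightarrow> b \<in> B x \<Longrightarrow> \<exists>c\<in>C x. H #> (a \<otimes> b) = H #> c"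
    and a: "a \<in> list_set_mult A xs" and b: "b \<in> list_set_mult B xs"
  shows "\<exists>c\<in>list_set_mult C xs. H #> (a \<otimes> b) = H #> c"
  using assms
proof (induction xs arbitrary: a b)
  case (Cons x xs)
  interpret Q: group "G Mod H" by (rule factorgroup_is_group)
  obtain a1 a2 where a: "a = a1 \<otimes> a2" "a1 \<in> A x" "a2 \<in> list_set_mult A xs"
    using Cons.prems(6) by (auto simp: set_mult_def)
  obtain b1 b2 where b: "b = b1 \<otimes> b2" "b1 \<in> B x" "b2 \<in> list_set_mult B xs"
    using Cons.prems(7) by (auto simp: set_mult_def)
  obtain c1 where c1: "c1 \<in> C x" "H #> (a1 \<otimes> b1) = H #> c1"
    using Cons.prems(5)[of x a1 b1] a b by auto
  obtain c2 where c2: "c2 \<in> list_set_mult C xs" "H #> (a2 \<otimes> b2) = H #> c2"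
  proof -
    note prems = Cons.prems(1-5)[OF list.set_intros(2)]
    have "\<exists>c\<in>list_set_mult C xs. H #> (a2 \<otimes> b2) = H #> c"
      by (rule Cons.IH) (rule prems a(3) b(3); assumption)+
    with that show ?thesis by blast
  qed
  have "A x \<subseteq> carrier G" "B x \<subseteq> carrier G" "C x \<subseteq> carrier G"
    by (rule Cons.prems(1-3), simp)+
  then have cl1: "a1 \<in> carrier G" "b1 \<in> carrier G" "c1 \<in> carrier G"
    using a(2) b(2) c1(1) by blast+
  have "list_set_mult A xs \<subseteq> carrier G" "list_set_mult B xs \<subseteq> carrier G"
    "list_set_mult C xs \<subseteq> carrier G"
    by (rule list_set_mult_carrier, rule Cons.prems(1-3), simp)+
  then have cl2: "a2 \<in> carrier G" "b2 \<in> carrier G" "c2 \<in> carrier G"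
    using a(3) b(3) c2(1) by blast+
  note cl = cl1 cl2
  have "commutator b1 a2 \<in> H" using Cons.prems(4)[of x b1 a2] b cl by auto
  then have "H #> (b1 \<otimes> a2) = H #> (a2 \<otimes> b1)" using cl coset_commute_iff by simp
  then have sw: "(H #> a2) \<otimes>\<^bsub>G Mod H\<^esub> (H #> b1) = (H #> b1) \<otimes>\<^bsub>G Mod H\<^esub> (H #> a2)"
    using cl by (simp add: coset_mult del: mult_FactGroup)
  have "H #> (a \<otimes> b) = (H #> a1) \<otimes>\<^bsub>G Mod H\<^esub> ((H #> a2) \<otimes>\<^bsub>G Mod H\<^esub> (H #> b1)) \<otimes>\<^bsub>G Mod H\<^esub> (H #> b2)"
    using a b cl by (simp add: coset_mult coset_carrier Q.m_assoc del: mult_FactGroup)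
  also have "\<dots> = ((H #> a1) \<otimes>\<^bsub>G Mod H\<^esub> (H #> b1)) \<otimes>\<^bsub>G Mod H\<^esub> ((H #> a2) \<otimes>\<^bsub>G Mod H\<^esub> (H #> b2))"
    unfolding sw using cl by (simp add: coset_carrier Q.m_assoc del: mult_FactGroup)
  also have "\<dots> = H #> (c1 \<otimes> c2)"
    using c1 c2 cl by (simp add: coset_mult[symmetric] del: mult_FactGroup)
  finally show ?case using c1 c2 by (auto simp: set_mult_def)
qed auto

section \<open>Topological groups and closed hulls\<close>

context topological_group
begin

lemma continuous_map_mult:
  assumes "continuous_map X T f" "continuous_map X T g"
  shows "continuous_map X T (\<lambda>x. f x \<otimes> g x)"
  using continuous_map_compose[OF continuous_map_pairedI[OF assms] continuous_mult]
  by (simp add: o_def)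

lemma continuous_map_inv:
  assumes "continuous_map X T f"
  shows "continuous_map X T (\<lambda>x. inv f x)"
  using continuous_map_compose[OF assms continuous_inv] by (simp add: o_def)

lemma continuous_map_nat_pow:
  assumes "continuous_map X T f"
  shows "continuous_map X T (\<lambda>x. f x [^] (n::nat))"
  by (induction n) (simp_all add: continuous_map_mult assms topspace_eq)

lemma continuous_map_id_T: "continuous_map T T (\<lambda>x. x)"
  by simp

lemma continuous_map_const_T: "a \<in> carrier G \<Longrightarrow> continuous_map X T (\<lambda>x. a)"
  by (simp add: topspace_eq)

lemmas continuous_group_intros =
  continuous_map_mult continuous_map_inv continuous_map_nat_pow
  continuous_map_id_T continuous_map_const_T

lemma closedin_preimage:
  assumes "continuous_map T T f" "closedin T C"
  shows "closedin T {x \<in> carrier G. f x \<in> C}"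
  using closedin_continuous_map_preimage[OF assms] by (simp add: topspace_eq)

lemma openin_preimage:
  assumes "continuous_map T T f" "openin T C"
  shows "openin T {x \<in> carrier G. f x \<in> C}"
  using openin_continuous_map_preimage[OF assms] by (simp add: topspace_eq)

lemma openin_carrier: "openin T A \<Longrightarrow> A \<subseteq> carrier G"
  using openin_subset topspace_eq by blast

lemma closedin_carrier: "closedin T A \<Longrightarrow> A \<subseteq> carrier G"
  using closedin_subset topspace_eq by blast

lemma r_coset_eq_preimage:
  assumes "A \<subseteq> carrier G" "a \<in> carrier G"
  shows "A #> a = {x \<in> carrier G. x \<otimes> inv a \<in> A}"
proof -
  have "x = x \<otimes> inv a \<otimes> a" if "x \<in> carrier G" for x
    using assms that by (simp add: m_assoc)
  moreover have "h \<otimes> a \<otimes> inv a = h" if "h \<in> A" for h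
    using assms that by (simp add: m_assoc subsetD)
  ultimately show ?thesis
    using assms by (fastforce simp: r_coset_def)
qed

lemma openin_r_coset:
  assumes "openin T A" "a \<in> carrier G" shows "openin T (A #> a)"
  unfolding r_coset_eq_preimage[OF openin_carrier[OF assms(1)] assms(2)]
  by (rule openin_preimage[OF _ assms(1)]) (intro continuous_group_intros inv_closed assms)

lemma closedin_r_coset:
  assumes "closedin T A" "a \<in> carrier G" shows "closedin T (A #> a)"
  unfolding r_coset_eq_preimage[OF closedin_carrier[OF assms(1)] assms(2)]
  by (rule closedin_preimage[OF _ assms(1)]) (intro continuous_group_intros inv_closed assms)

lemma subgroup_complement_eq:
  assumes "subgroup H G"
  shows "carrier G - H = \<Union>(rcosets H - {H})"
proof -
  have "H \<in> rcosets H" using assms by (simp add: subgroup.subgroup_in_rcosets is_group)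
  then show ?thesis
    using rcos_disjoint[OF assms] rcosets_part_G[OF assms]
    by (auto simp: disjoint_def pairwise_def disjnt_def)
qed

lemma open_subgroup_closed:
  assumes "subgroup H G" "openin T H" shows "closedin T H"
proof -
  have "openin T (\<Union>(rcosets H - {H}))"
    using openin_r_coset[OF assms(2)] by (auto simp: RCOSETS_def)
  then show ?thesis
    using openin_carrier[OF assms(2)]
    by (simp add: closedin_def topspace_eq subgroup_complement_eq[OF assms(1)])
qed

text \<open>The complement is a finite union of cosets, which are closed.\<close>
lemma closed_subgroup_open_of_finite_index:
  assumes "subgroup H G" "closedin T H" "finite (rcosets H)"
  shows "openin T H"
proof -
  have "closedin T (\<Union>(rcosets H - {H}))"
    using closedin_r_coset[OF assms(2)] assms(3)
    by (intro closedin_Union) (auto simp: RCOSETS_def)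
  then show ?thesis
    using closedin_carrier[OF assms(2)]
    by (simp add: openin_closedin_eq topspace_eq subgroup_complement_eq[OF assms(1)])
qed

lemma subgroup_open_of_open_subset:
  assumes "subgroup H G" "openin T W" "\<one> \<in> W" "W \<subseteq> H"
  shows "openin T H"
proof -
  have "H = (\<Union>h\<in>H. W #> h)"
  proof
    show "(\<Union>h\<in>H. W #> h) \<subseteq> H"
      using assms(4) subgroup.m_closed[OF assms(1)] by (auto simp: r_coset_def)
    show "H \<subseteq> (\<Union>h\<in>H. W #> h)"
      using assms(3) subgroup.mem_carrier[OF assms(1)] by (force simp: r_coset_def)
  qed
  moreover have "openin T (\<Union>h\<in>H. W #> h)"
    using openin_r_coset[OF assms(2)] subgroup.mem_carrier[OF assms(1)] by auto
  ultimately show ?thesis by simp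
qed

text \<open>The closed subgroup topologically generated by \<open>X\<close>. Defined as an intersection, it is a closed subgroup by construction,
  and inclusions into closed subgroups are checked on \<open>X\<close>.\<close>
definition closed_hull :: "'g set \<Rightarrow> 'g set" where
  "closed_hull X = \<Inter>{H. subgroup H G \<and> closedin T H \<and> X \<subseteq> H}"

lemma closed_hull_minimal:
  "subgroup H G \<Longrightarrow> closedin T H \<Longrightarrow> X \<subseteq> H \<Longrightarrow> closed_hull X \<subseteq> H"
  by (auto simp: closed_hull_def)

lemma closed_hull_incl: "X \<subseteq> closed_hull X"
  by (auto simp: closed_hull_def)

lemma carrier_in_closed_hull:
  assumes "X \<subseteq> carrier G"
  shows "carrier G \<in> {H. subgroup H G \<and> closedin T H \<and> X \<subseteq> H}"
  using assms closedin_topspace[of T] subgroup_self by (simp add: topspace_eq)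

lemma closed_hull_subgroup: "X \<subseteq> carrier G \<Longrightarrow> subgroup (closed_hull X) G"
  unfolding closed_hull_def
  by (rule subgroups_Inter) (use carrier_in_closed_hull in blast)+

lemma closed_hull_closed: "X \<subseteq> carrier G \<Longrightarrow> closedin T (closed_hull X)"
  unfolding closed_hull_def
  by (rule closedin_Inter) (use carrier_in_closed_hull in blast)+

lemma closed_hull_mono: "X \<subseteq> Y \<Longrightarrow> closed_hull X \<subseteq> closed_hull Y"
  by (auto simp: closed_hull_def)

lemma conj_preimage_subgroup:
  assumes H: "subgroup H G" and g: "g \<in> carrier G"
  shows "subgroup {x \<in> carrier G. g \<otimes> x \<otimes> inv g \<in> H} G"
proof (rule subgroupI)
  interpret H: subgroup H G by fact
  show "{x \<in> carrier G. g \<otimes> x \<otimes> inv g \<in> H} \<noteq> {}"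
    using g by (auto intro!: exI[of _ \<one>])
  fix x assume x: "x \<in> {x \<in> carrier G. g \<otimes> x \<otimes> inv g \<in> H}"
  have "inv (g \<otimes> x \<otimes> inv g) = g \<otimes> inv x \<otimes> inv g"
    using x g by (simp add: inv_mult_group m_assoc)
  then show "inv x \<in> {x \<in> carrier G. g \<otimes> x \<otimes> inv g \<in> H}"
    using x H.m_inv_closed by fastforce
  fix y assume y: "y \<in> {x \<in> carrier G. g \<otimes> x \<otimes> inv g \<in> H}"
  have "g \<otimes> (x \<otimes> y) \<otimes> inv g = (g \<otimes> x \<otimes> inv g) \<otimes> (g \<otimes> y \<otimes> inv g)"
    using x y g by (simp add: m_assoc inv_solve_left')
      (simp add: m_assoc[symmetric])
  then show "x \<otimes> y \<in> {x \<in> carrier G. g \<otimes> x \<otimes> inv g \<in> H}"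
    using x y by auto
qed auto

lemma closed_hull_normal:
  assumes X: "X \<subseteq> carrier G"
    and conj: "\<And>g x. g \<in> carrier G \<Longrightarrow> x \<in> X \<Longrightarrow> g \<otimes> x \<otimes> inv g \<in> X"
  shows "closed_hull X \<lhd> G"
  unfolding normal_inv_iff
proof (intro conjI ballI)
  show sub: "subgroup (closed_hull X) G" using X by (rule closed_hull_subgroup)
  fix g x assume g: "g \<in> carrier G" and x: "x \<in> closed_hull X"
  have "closed_hull X \<subseteq> {x \<in> carrier G. g \<otimes> x \<otimes> inv g \<in> closed_hull X}"
  proof (rule closed_hull_minimal)
    show "closedin T {x \<in> carrier G. g \<otimes> x \<otimes> inv g \<in> closed_hull X}"
      using closed_hull_closed[OF X]
      by (intro closedin_preimage continuous_group_intros inv_closed g)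
    show "X \<subseteq> {x \<in> carrier G. g \<otimes> x \<otimes> inv g \<in> closed_hull X}"
      using X conj[OF g] closed_hull_incl by blast
  qed (rule conj_preimage_subgroup[OF sub g])
  with x show "g \<otimes> x \<otimes> inv g \<in> closed_hull X" by blast
qed

end

locale compact_group = topological_group +
  assumes compact: "compact_space T" and Hausdorff: "Hausdorff_space T"
begin

lemma closedin_set_mult:
  assumes "closedin T A" "closedin T B" shows "closedin T (A <#> B)"
proof -
  have "compactin (prod_topology T T) (A \<times> B)"
    using assms compact by (simp add: compactin_Times closedin_compact_space)
  then have "compactin T ((\<lambda>(x, y). x \<otimes> y) ` (A \<times> B))"
    by (rule image_compactin[OF _ continuous_mult])
  moreover have "(\<lambda>(x, y). x \<otimes> y) ` (A \<times> B) = A <#> B"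
    by (auto simp: set_mult_def)
  ultimately show ?thesis using compactin_imp_closedin Hausdorff by metis
qed

lemma closedin_image:
  assumes "continuous_map T T f" "closedin T A" shows "closedin T (f ` A)"
  using assms compact Hausdorff
  by (meson closedin_compact_space compactin_imp_closedin image_compactin)

lemma closedin_singleton: "x \<in> carrier G \<Longrightarrow> closedin T {x}"
  using Hausdorff by (simp add: closedin_Hausdorff_singleton topspace_eq)

lemma closedin_finite: "finite A \<Longrightarrow> A \<subseteq> carrier G \<Longrightarrow> closedin T A"
proof (induction A rule: finite_induct)
  case (insert x A)
  then have "closedin T ({x} \<union> A)" using closedin_singleton by (intro closedin_Un) auto
  then show ?case by simp
qed simp

lemma list_set_mult_closed:
  assumes "\<And>x. x \<in> set xs \<Longrightarrow> closedin T (A x)"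
  shows "closedin T (list_set_mult A xs)"
  using assms by (induction xs) (auto simp: closedin_singleton closedin_set_mult)

lemma open_subgroup_finite_index:
  assumes "subgroup H G" "openin T H" shows "finite (rcosets H)"
proof -
  have "\<forall>C\<in>rcosets H. openin T C"
    using openin_r_coset[OF assms(2)] by (auto simp: RCOSETS_def)
  then obtain \<F> where F: "finite \<F>" "\<F> \<subseteq> rcosets H" "carrier G \<subseteq> \<Union>\<F>"
    using compact rcosets_part_G[OF assms(1)] unfolding compact_space_alt topspace_eq
    by (metis order_refl)
  have "rcosets H \<subseteq> \<F>"
  proof
    fix C assume C: "C \<in> rcosets H"
    then obtain x where x: "x \<in> C" "x \<in> carrier G"
      using subgroup.rcosets_non_empty[OF assms(1) C] subgroup.rcosets_carrier[OF assms(1) is_group C]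
      by blast
    with F obtain D where D: "D \<in> \<F>" "x \<in> D" by blast
    then have "C = D"
      using rcos_disjoint[OF assms(1)] C F(2) x(1)
      by (auto simp: disjoint_def pairwise_def disjnt_def)
    with D show "C \<in> \<F>" by simp
  qed
  then show ?thesis using F(1) finite_subset by blast
qed

text \<open>The conjugates of \<open>H\<close> depend only on the coset of the conjugating element. There are finitely many cosets, so the
  intersection of all conjugates is open.\<close>
lemma open_subgroup_core:
  assumes H: "subgroup H G" and oH: "openin T H"
  obtains N where "N \<lhd> G" "openin T N" "N \<subseteq> H"
proof -
  interpret H: subgroup H G by (rule H)
  let ?c = "\<lambda>r. {x \<in> carrier G. r \<otimes> x \<otimes> inv r \<in> H}"
  define N where "N = (\<Inter>r\<in>carrier G. ?c r)"
  have mult: "\<And>x y z. x \<in> carrier G \<Longrightarrow> y \<in> carrier G \<Longrightarrow> z \<in> carrier G \<Longrightarrow>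
      (x \<otimes> y) \<otimes> z \<otimes> inv (x \<otimes> y) = x \<otimes> (y \<otimes> z \<otimes> inv y) \<otimes> inv x"
    by (simp add: inv_mult_group m_assoc)
  have sub: "subgroup N G"
    unfolding N_def by (rule subgroups_Inter) (auto intro: conj_preimage_subgroup[OF H])
  have "\<exists>f. \<forall>C\<in>rcosets H. f C \<in> C \<and> f C \<in> carrier G \<and> C = H #> f C"
  proof (rule bchoice, rule ballI)
    fix C assume "C \<in> rcosets H"
    then obtain a where "a \<in> carrier G" "C = H #> a" by (auto simp: RCOSETS_def)
    then show "\<exists>y. y \<in> C \<and> y \<in> carrier G \<and> C = H #> y"
      using rcos_self[OF _ H] by blast
  qed
  then obtain f where f: "\<And>C. C \<in> rcosets H \<Longrightarrow> f C \<in> carrier G \<and> C = H #> f C" by blast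
  \<comment> \<open>It suffices to intersect over representatives \<open>f C\<close> of the cosets.\<close>
  have "N = (\<Inter>r\<in>f ` (rcosets H). ?c r)"
  proof
    show "N \<subseteq> (\<Inter>r\<in>f ` (rcosets H). ?c r)" unfolding N_def using f by blast
    show "(\<Inter>r\<in>f ` (rcosets H). ?c r) \<subseteq> N"
    proof
      fix x assume x: "x \<in> (\<Inter>r\<in>f ` (rcosets H). ?c r)"
      have xc: "x \<in> carrier G" using x H.subgroup_in_rcosets[OF is_group] by blast
      have "g \<otimes> x \<otimes> inv g \<in> H" if g: "g \<in> carrier G" for g
      proof -
        have C: "H #> g \<in> rcosets H" using g H.subset rcosetsI by blast
        let ?r = "f (H #> g)"
        have "g \<in> H #> ?r" using f[OF C] rcos_self[OF g H] by simp
        then obtain h where h: "h \<in> H" "g = h \<otimes> ?r" by (auto simp: r_coset_def)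
        have "?r \<otimes> x \<otimes> inv ?r \<in> H" using x C by blast
        then have "h \<otimes> (?r \<otimes> x \<otimes> inv ?r) \<otimes> inv h \<in> H" using h by simp
        then show ?thesis using mult[of h ?r x] h f[OF C] xc by simp
      qed
      then show "x \<in> N" using xc by (simp add: N_def)
    qed
  qed
  moreover have "openin T (\<Inter>r\<in>f ` (rcosets H). ?c r)"
  proof (rule openin_Inter)
    show "finite (?c ` f ` (rcosets H))" using open_subgroup_finite_index[OF assms] by simp
    show "?c ` f ` (rcosets H) \<noteq> {}" using H.subgroup_in_rcosets[OF is_group] by blast
    fix X assume "X \<in> ?c ` f ` (rcosets H)"
    then obtain r where r: "r \<in> carrier G" "X = ?c r" using f by auto
    show "openin T X"
      unfolding r(2) by (intro openin_preimage continuous_group_intros inv_closed r(1) oH)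
  qed
  ultimately have "openin T N" by simp
  moreover have "N \<lhd> G"
    unfolding normal_inv_iff
  proof (intro conjI ballI sub)
    fix g x assume g: "g \<in> carrier G" and x: "x \<in> N"
    then have xc: "x \<in> carrier G" by (auto simp: N_def)
    have "r \<otimes> (g \<otimes> x \<otimes> inv g) \<otimes> inv r \<in> H" if "r \<in> carrier G" for r
    proof -
      have "(r \<otimes> g) \<otimes> x \<otimes> inv (r \<otimes> g) \<in> H" using x g that by (auto simp: N_def)
      then show ?thesis using mult g xc that by simp
    qed
    then show "g \<otimes> x \<otimes> inv g \<in> N" using g xc by (simp add: N_def)
  qed
  moreover have "N \<subseteq> H"
  proof
    fix x assume x: "x \<in> N"
    then have "x \<in> carrier G" "\<one> \<otimes> x \<otimes> inv \<one> \<in> H" unfolding N_def by blast+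
    then show "x \<in> H" by simp
  qed
  ultimately show thesis using that by blast
qed

lemma commute_subgroup:
  assumes "a \<in> carrier G"
  shows "subgroup {x \<in> carrier G. x \<otimes> a = a \<otimes> x} G"
proof (rule subgroupI)
  fix x y assume "x \<in> {x \<in> carrier G. x \<otimes> a = a \<otimes> x}" "y \<in> {x \<in> carrier G. x \<otimes> a = a \<otimes> x}"
  then show "x \<otimes> y \<in> {x \<in> carrier G. x \<otimes> a = a \<otimes> x}"
    using assms by (metis (mono_tags, lifting) m_assoc m_closed mem_Collect_eq)
next
  fix x assume "x \<in> {x \<in> carrier G. x \<otimes> a = a \<otimes> x}"
  then show "inv x \<in> {x \<in> carrier G. x \<otimes> a = a \<otimes> x}"
    using assms by (metis (mono_tags, lifting) inv_closed inv_solve_left inv_solve_right m_assoc m_closed mem_Collect_eq)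
qed (use assms in auto)

lemma commute_closed:
  assumes "a \<in> carrier G"
  shows "closedin T {x \<in> carrier G. x \<otimes> a = a \<otimes> x}"
proof -
  have "{x \<in> carrier G. x \<otimes> a = a \<otimes> x} = {x \<in> carrier G. x \<otimes> a \<otimes> inv (a \<otimes> x) \<in> {\<one>}}"
    using assms by (auto simp: r_inv) (metis inv_equality inv_inv inv_closed m_closed)
  also have "closedin T \<dots>"
    by (intro closedin_preimage continuous_group_intros closedin_singleton one_closed assms)
  finally show ?thesis .
qed

text \<open>Centralizers are closed: \<open>s\<close> commutes with itself, hence with the whole hull, and
  then every element of the hull commutes with the whole hull.\<close>
lemma closed_hull_singleton_commute:
  assumes s: "s \<in> carrier G" and a: "a \<in> closed_hull {s}" and b: "b \<in> closed_hull {s}"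
  shows "a \<otimes> b = b \<otimes> a"
proof -
  have "closed_hull {s} \<subseteq> {x \<in> carrier G. x \<otimes> s = s \<otimes> x}"
    using s by (intro closed_hull_minimal commute_subgroup commute_closed) auto
  then have b': "b \<in> carrier G" "b \<otimes> s = s \<otimes> b" using b by auto
  have "closed_hull {s} \<subseteq> {x \<in> carrier G. x \<otimes> b = b \<otimes> x}"
    using s b' by (intro closed_hull_minimal commute_subgroup commute_closed) auto
  with a show ?thesis by auto
qed

text \<open>On the commutative hull of \<open>s\<close> the power map is a homomorphism, and by compactness its image is closed.
  So not only the powers of \<open>s [^] n\<close> but also all their limits are \<open>n\<close>-th powers.\<close>
lemma closed_hull_pow_incl:
  assumes s: "s \<in> carrier G"
  shows "closed_hull {s [^] (n::nat)} \<subseteq> (\<lambda>b. b [^] n) ` closed_hull {s}"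
proof (rule closed_hull_minimal)
  have sub: "subgroup (closed_hull {s}) G" using s by (intro closed_hull_subgroup) auto
  interpret B: subgroup "closed_hull {s}" G by (rule sub)
  show "closedin T ((\<lambda>b. b [^] n) ` closed_hull {s})"
    using s by (intro closedin_image closed_hull_closed continuous_group_intros) auto
  show "{s [^] n} \<subseteq> (\<lambda>b. b [^] n) ` closed_hull {s}"
    using closed_hull_incl[of "{s}"] by auto
  show "subgroup ((\<lambda>b. b [^] n) ` closed_hull {s}) G"
  proof (rule subgroupI)
    show "(\<lambda>b. b [^] n) ` closed_hull {s} \<subseteq> carrier G" using B.subset by auto
    show "(\<lambda>b. b [^] n) ` closed_hull {s} \<noteq> {}" using B.one_closed by blast
    fix x assume "x \<in> (\<lambda>b. b [^] n) ` closed_hull {s}"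
    then obtain a where a: "a \<in> closed_hull {s}" "x = a [^] n" by auto
    then show "inv x \<in> (\<lambda>b. b [^] n) ` closed_hull {s}"
      using nat_pow_inv[of a n] by (auto intro!: image_eqI[of _ _ "inv a"])
    fix y assume "y \<in> (\<lambda>b. b [^] n) ` closed_hull {s}"
    then obtain b where b: "b \<in> closed_hull {s}" "y = b [^] n" by auto
    have "(a \<otimes> b) [^] n = a [^] n \<otimes> b [^] n"
      using a b closed_hull_singleton_commute[OF s a(1) b(1)] by (intro pow_mult_distrib) auto
    then show "x \<otimes> y \<in> (\<lambda>b. b [^] n) ` closed_hull {s}"
      using a b by (auto intro!: image_eqI[of _ _ "a \<otimes> b"])
  qed
qed

end

section \<open>The lower \<open>p\<close>-series of a pro-\<open>p\<close> group\<close>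

locale pro_p = compact_group +
  fixes p :: nat
  assumes prime_p: "Factorial_Ring.prime p"
    and subgroup_basis: "openin T W \<Longrightarrow> \<one> \<in> W \<Longrightarrow> \<exists>H. subgroup H G \<and> openin T H \<and> H \<subseteq> W"
    and index_pow_p: "N \<lhd> G \<Longrightarrow> openin T N \<Longrightarrow> \<exists>m. card (rcosets N) = p ^ m"
begin

text \<open>What must be killed to make the image of \<open>A\<close> central and of exponent \<open>p\<close>.\<close>
definition p_central_gens :: "'a set \<Rightarrow> 'a set" where
  "p_central_gens A = (\<lambda>x. x [^] p) ` A \<union> (\<lambda>(x, g). commutator x g) ` (A \<times> carrier G)"

text \<open>Each step passes to the smallest closed subgroup modulo which the previous term becomes central
  of exponent \<open>p\<close>. Indexing starts at \<open>0\<close>, so \<open>lower_p_series m\<close> is what is usually called \<open>P\<^sub>m\<^sub>+\<^sub>1\<close>.\<close>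
primrec lower_p_series :: "nat \<Rightarrow> 'a set" where
  "lower_p_series 0 = carrier G"
| "lower_p_series (Suc m) = closed_hull (p_central_gens (lower_p_series m))"

abbreviation "F \<equiv> lower_p_series"

lemma p_central_gens_carrier: "A \<subseteq> carrier G \<Longrightarrow> p_central_gens A \<subseteq> carrier G"
  by (auto simp: p_central_gens_def subsetD)

lemma F_carrier: "F m \<subseteq> carrier G"
proof (induction m)
  case (Suc m)
  then show ?case
    using subgroup.subset[OF closed_hull_subgroup[OF p_central_gens_carrier[OF Suc]]] by simp
qed simp

lemma F_subgroup: "subgroup (F m) G"
  by (cases m) (auto intro!: closed_hull_subgroup p_central_gens_carrier subgroup_self
      simp: subsetD[OF F_carrier])

lemma F_closed: "closedin T (F m)"
proof (cases m)
  case 0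
  then show ?thesis using closedin_topspace[of T] by (simp add: topspace_eq)
next
  case (Suc m)
  then show ?thesis
    by (simp add: closed_hull_closed p_central_gens_carrier F_carrier)
qed

text \<open>The generators of each term grow with the previous term, so the inclusion propagates by monotonicity.\<close>
lemma F_Suc_subset: "F (Suc m) \<subseteq> F m"
proof (induction m)
  case (Suc m)
  then have "p_central_gens (F (Suc m)) \<subseteq> p_central_gens (F m)"
    by (auto simp: p_central_gens_def simp del: lower_p_series.simps)
  then show ?case using closed_hull_mono by simp
qed (use F_carrier[of 1] in simp)

lemma F_antimono: "m \<le> n \<Longrightarrow> F n \<subseteq> F m"
  by (rule lift_Suc_antimono_le[of F]) (rule F_Suc_subset)

lemma pow_mem_F: "x \<in> F m \<Longrightarrow> x [^] p \<in> F (Suc m)"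
  using closed_hull_incl[of "p_central_gens (F m)"] by (auto simp: p_central_gens_def)

lemma commutator_mem_F: "x \<in> F m \<Longrightarrow> g \<in> carrier G \<Longrightarrow> commutator x g \<in> F (Suc m)"
  using closed_hull_incl[of "p_central_gens (F m)"] by (force simp: p_central_gens_def)

lemma F_Suc_minimal:
  assumes "subgroup H G" "closedin T H" "\<And>x. x \<in> F m \<Longrightarrow> x [^] p \<in> H"
    "\<And>x g. x \<in> F m \<Longrightarrow> g \<in> carrier G \<Longrightarrow> commutator x g \<in> H"
  shows "F (Suc m) \<subseteq> H"
  unfolding lower_p_series.simps
  by (rule closed_hull_minimal[OF assms(1,2)]) (use assms(3,4) in \<open>auto simp: p_central_gens_def\<close>)

text \<open>The conjugate of \<open>x\<close> differs from \<open>x\<close> by a commutator, and commutators of elements of a term lie in that term.\<close>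
lemma F_normal: "F m \<lhd> G"
  unfolding normal_inv_iff
proof (intro conjI ballI F_subgroup)
  fix g x assume g: "g \<in> carrier G" and x: "x \<in> F m"
  interpret S: subgroup "F m" G by (rule F_subgroup)
  have xc: "x \<in> carrier G" using x S.mem_carrier by blast
  have "commutator x (inv g) \<in> F m"
    using commutator_mem_F[OF x inv_closed[OF g]] F_Suc_subset by blast
  then have "x \<otimes> commutator x (inv g) \<in> F m" using x by blast
  moreover have "x \<otimes> commutator x (inv g) = g \<otimes> x \<otimes> inv g"
    using xc g by (simp add: commutator_def m_assoc[symmetric])
  ultimately show "g \<otimes> x \<otimes> inv g \<in> F m" by simp
qed

lemma pow_pow_mem_F: "x \<in> F m \<Longrightarrow> x [^] (p ^ k) \<in> F (m + k)"
proof (induction k)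
  case (Suc k)
  have "x [^] (p ^ Suc k) = (x [^] (p ^ k)) [^] p"
    using subsetD[OF F_carrier Suc.prems] by (simp add: nat_pow_pow mult.commute)
  then show ?case using pow_mem_F[OF Suc.IH[OF Suc.prems]] by simp
qed (use subsetD[OF F_carrier] in simp)

text \<open>Here the pro-\<open>p\<close> hypothesis enters. A proper \<open>N\<close> is enlarged to the preimage \<open>M\<close> of the
  \<open>p\<close>-torsion of the centre of the \<open>p\<close>-group \<open>G / N\<close>. This has smaller index, so it contains some \<open>F k\<close>,
  and then \<open>N\<close> contains \<open>F (k + 1)\<close> by the choice of \<open>M\<close>.\<close>
lemma F_le_open_normal:
  assumes "N \<lhd> G" "openin T N"
  shows "\<exists>k. F k \<subseteq> N"
  using assms
proof (induction "card (rcosets N)" arbitrary: N rule: less_induct)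
  case less
  interpret N: normal N G by (rule less.prems)
  interpret Q: group "G Mod N" by (rule N.factorgroup_is_group)
  show ?case
  proof (cases "N = carrier G")
    case True
    then show ?thesis by (auto intro: exI[of _ 0])
  next
    case False
    \<comment> \<open>The pro-\<open>p\<close> hypothesis makes the quotient a \<open>p\<close>-group.\<close>
    obtain m where m: "card (rcosets N) = p ^ m" using index_pow_p less.prems by blast
    have ord: "order (G Mod N) = p ^ m" using m by (simp add: order_def FactGroup_def)
    have "m > 0"
    proof (rule ccontr)
      assume "\<not> m > 0"
      then have "card (rcosets N) = 1" using m by simp
      then obtain C where C: "rcosets N = {C}" using card_1_singletonE by blast
      moreover have "N \<in> rcosets N" by (rule N.subgroup_in_rcosets[OF is_group])
      ultimately have "\<Union>(rcosets N) = N" by auto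
      then show False using False rcosets_part_G[OF N.is_subgroup] by simp
    qed
    then obtain z where z: "z \<in> carrier (G Mod N)" "z \<noteq> \<one>\<^bsub>G Mod N\<^esub>" "z [^]\<^bsub>G Mod N\<^esub> p = \<one>\<^bsub>G Mod N\<^esub>"
      "\<And>g. g \<in> carrier (G Mod N) \<Longrightarrow> g \<otimes>\<^bsub>G Mod N\<^esub> z = z \<otimes>\<^bsub>G Mod N\<^esub> g"
      using Q.p_group_central_element[OF prime_p ord] by blast
    obtain x where x: "x \<in> carrier G" "z = N #> x" using z(1) by (auto simp: carrier_FactGroup)
    \<comment> \<open>This \<open>M\<close> is made so that the next term of the series lands in \<open>N\<close>.\<close>
    define M where "M = {h \<in> carrier G. h [^] p \<in> N \<and> (\<forall>g\<in>carrier G. commutator h g \<in> N)}"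
    have M: "subgroup M G" unfolding M_def by (rule N.central_torsion_mod_subgroup)
    have comm_N: "commutator y g \<in> N" if "y \<in> N" "g \<in> carrier G" for y g
    proof -
      have "commutator y g = inv y \<otimes> (inv g \<otimes> y \<otimes> g)"
        using that by (simp add: commutator_def m_assoc)
      then show ?thesis using that N.inv_op_closed1 by simp
    qed
    have NM: "N \<subseteq> M" using comm_N subgroup_nat_pow_closed[OF N.is_subgroup] by (auto simp: M_def)
    have "x \<in> M"
    proof -
      have "N #> (x [^] p) = N" using z(3) x by (simp add: N.coset_pow)
      then have "x [^] p \<in> N" using coset_join1[OF _ _ N.is_subgroup] x(1) by blast
      moreover have "commutator x g \<in> N" if g: "g \<in> carrier G" for g
        using z(4)[OF N.coset_carrier[OF g]] x g N.coset_mult_commute_iff[of x g] by simp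
      ultimately show ?thesis using x by (simp add: M_def)
    qed
    moreover have "x \<notin> N" using z(2) x by auto
    ultimately have strict: "N \<subset> M" using NM by blast
    have "M \<lhd> G"
      unfolding normal_inv_iff
    proof (intro conjI ballI M)
      fix g h assume g: "g \<in> carrier G" and h: "h \<in> M"
      then have hc: "h \<in> carrier G" by (simp add: M_def)
      have "commutator h (inv g) \<in> M" using h g NM by (auto simp: M_def)
      then have "h \<otimes> commutator h (inv g) \<in> M" using h subgroup.m_closed[OF M] by blast
      moreover have "h \<otimes> commutator h (inv g) = g \<otimes> h \<otimes> inv g"
        using hc g by (simp add: commutator_def m_assoc[symmetric])
      ultimately show "g \<otimes> h \<otimes> inv g \<in> M" by simp
    qed
    moreover have "openin T M"
      using subgroup_open_of_open_subset[OF M less.prems(2) N.one_closed NM] .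
    moreover have "card (rcosets M) < card (rcosets N)"
      using card_rcosets_less[OF N.is_subgroup M strict]
        open_subgroup_finite_index[OF N.is_subgroup less.prems(2)] by simp
    ultimately obtain k where k: "F k \<subseteq> M" using less.hyps by blast
    have "F (Suc k) \<subseteq> N"
      by (rule F_Suc_minimal[OF N.is_subgroup open_subgroup_closed[OF N.is_subgroup less.prems(2)]])
        (use k in \<open>auto simp: M_def\<close>)
    then show ?thesis by blast
  qed
qed

lemma F_basis:
  assumes "openin T W" "\<one> \<in> W" shows "\<exists>k. F k \<subseteq> W"
proof -
  obtain H where H: "subgroup H G" "openin T H" "H \<subseteq> W" using subgroup_basis assms by blast
  obtain N where "N \<lhd> G" "openin T N" "N \<subseteq> H" using open_subgroup_core[OF H(1,2)] .
  then show ?thesis using F_le_open_normal H(3) by blast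
qed

text \<open>The terms of the series are a base of neighbourhoods of \<open>\<one>\<close>, so an element outside of a
  closed set is separated from it modulo some term.\<close>
lemma mem_closed_of_approx:
  assumes P: "closedin T P" and x: "x \<in> carrier G"
    and approx: "\<And>k. \<exists>q\<in>P. F k #> x = F k #> q"
  shows "x \<in> P"
proof (rule ccontr)
  assume "x \<notin> P"
  let ?W = "{u \<in> carrier G. x \<otimes> u \<in> carrier G - P}"
  have "openin T (carrier G - P)"
    using P by (simp add: closedin_def topspace_eq)
  then have "openin T ?W" by (intro openin_preimage continuous_group_intros x)
  moreover have "\<one> \<in> ?W" using x \<open>x \<notin> P\<close> by simp
  ultimately obtain k where k: "F k \<subseteq> ?W" using F_basis by blast
  interpret N: normal "F k" G by (rule F_normal)
  obtain q where q: "q \<in> P" "F k #> q = F k #> x" using approx by metis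
  then obtain h where "h \<in> F k" "q = x \<otimes> h"
    using N.coset_eq_iff x closedin_carrier[OF P] by blast
  then show False using k q by blast
qed

text \<open>Modulo \<open>F k\<close> the order of \<open>y\<close> divides \<open>p\<^sup>k\<close>, hence \<open>y\<close> is a power of its \<open>m\<close>-th power by
  Bezout.\<close>
lemma mem_closed_hull_coprime_pow:
  assumes y: "y \<in> carrier G" and m: "coprime m p" "m > 0"
  shows "y \<in> closed_hull {y [^] m}"
proof (rule mem_closed_of_approx[OF _ y])
  let ?C = "closed_hull {y [^] m}"
  have sub: "subgroup ?C G" using y by (intro closed_hull_subgroup) auto
  show "closedin T ?C" using y by (intro closed_hull_closed) auto
  fix k
  interpret N: normal "F k" G by (rule F_normal)
  interpret C: subgroup ?C G by (rule sub)
  have "gcd m (p ^ k) = 1" using m(1) by (simp add: coprime_imp_gcd_eq_1)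
  then obtain e f where ef: "m * e = p ^ k * f + 1"
    using bezout_nat[of m "p ^ k"] m(2) by auto
  have yk: "y [^] (p ^ k) \<in> F k" using pow_pow_mem_F[of y 0 k] y by simp
  have "(y [^] m) [^] e = y \<otimes> (y [^] (p ^ k)) [^] f"
    using y ef by (simp add: nat_pow_pow nat_pow_Suc2[symmetric])
  moreover have "(y [^] (p ^ k)) [^] f \<in> F k" using yk by (induction f) auto
  ultimately have "F k #> ((y [^] m) [^] e) = F k #> y"
    using y by (subst N.coset_eq_iff) auto
  moreover have "(y [^] m) [^] e \<in> ?C"
    using closed_hull_incl[of "{y [^] m}"] by (induction e) auto
  ultimately show "\<exists>q\<in>?C. F k #> y = F k #> q" by metis
qed

end

section \<open>Powerful pro-\<open>p\<close> groups\<close>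

locale powerful_pro_p = pro_p +
  assumes comm_group_quotient:
    "comm_group (G Mod (T closure_of power_subgroup G (if p = 2 then 4 else p)))"
begin

text \<open>Usable form of powerfulness: commutators lie in every closed subgroup that contains the relevant
  powers. The closed hull \<open>C\<close> of these powers is normal and contains the closure of the subgroup
  they generate. An equation between products of cosets of that closure then yields an
  equation in the quotient by \<open>C\<close>.\<close>
lemma powerful_commutator:
  assumes H: "subgroup H G" "closedin T H"
    and pow: "\<And>x. x \<in> carrier G \<Longrightarrow> x [^] (if p = 2 then 4 else p) \<in> H"
    and a: "a \<in> carrier G" and b: "b \<in> carrier G"
  shows "commutator a b \<in> H"
proof -
  let ?n = "if p = 2 then 4 else p :: nat"
  let ?X = "(\<lambda>x. x [^] ?n) ` carrier G"
  let ?C = "closed_hull ?X" and ?N = "T closure_of power_subgroup G ?n"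
  have X: "?X \<subseteq> carrier G" by auto
  have conj_pow: "(g \<otimes> x \<otimes> inv g) [^] k = g \<otimes> x [^] k \<otimes> inv g"
    if "g \<in> carrier G" "x \<in> carrier G" for g x and k :: nat
  proof (induction k)
    case (Suc k)
    have "(g \<otimes> x \<otimes> inv g) [^] Suc k = (g \<otimes> x [^] k \<otimes> inv g) \<otimes> (g \<otimes> x \<otimes> inv g)"
      using Suc by simp
    also have "\<dots> = g \<otimes> x [^] Suc k \<otimes> inv g"
      using that by (simp add: m_assoc inv_cancel_left)
    finally show ?case .
  qed (use that in simp)
  have "?C \<lhd> G"
  proof (rule closed_hull_normal[OF X])
    fix g y assume g: "g \<in> carrier G" and "y \<in> ?X"
    then obtain x where x: "x \<in> carrier G" "y = x [^] ?n" by blast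
    then have "g \<otimes> y \<otimes> inv g = (g \<otimes> x \<otimes> inv g) [^] ?n"
      using conj_pow[OF g x(1)] by metis
    then show "g \<otimes> y \<otimes> inv g \<in> ?X" using g x by blast
  qed
  then interpret C: normal ?C G .
  have "power_subgroup G ?n \<subseteq> ?C"
    unfolding power_subgroup_def
    by (rule generate_subgroup_incl[OF closed_hull_incl C.is_subgroup])
  then have NC: "?N \<subseteq> ?C"
    using closed_hull_closed[OF X] by (rule closure_of_minimal)
  have "power_subgroup G ?n \<subseteq> ?N"
    unfolding power_subgroup_def
    using generate_incl[OF X] by (intro closure_of_subset) (simp add: topspace_eq)
  moreover have "\<one> \<in> power_subgroup G ?n"
    unfolding power_subgroup_def by (rule generate.one)
  ultimately have oneN: "\<one> \<in> ?N" by blast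
  have Nc: "?N \<subseteq> carrier G" using NC C.subset by blast
  have "(?N #> a) <#> (?N #> b) = (?N #> b) <#> (?N #> a)"
    using comm_groupE(4)[OF comm_group_quotient, of "?N #> a" "?N #> b"] a b
    by (simp add: carrier_FactGroup)
  moreover have "a \<otimes> b \<in> (?N #> a) <#> (?N #> b)"
  proof -
    have "\<one> \<otimes> a \<in> ?N #> a" "\<one> \<otimes> b \<in> ?N #> b" using oneN unfolding r_coset_def by blast+
    then have "a \<in> ?N #> a" "b \<in> ?N #> b" by (simp_all only: l_one a b)
    then show ?thesis unfolding set_mult_def by blast
  qed
  ultimately obtain n m where nm: "n \<in> ?N" "m \<in> ?N" "a \<otimes> b = (n \<otimes> b) \<otimes> (m \<otimes> a)"
    unfolding set_mult_def r_coset_def by blast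
  then have nmC: "n \<in> ?C" "m \<in> ?C" using NC by blast+
  have absorb: "?C #> (h \<otimes> x) = ?C #> x" if "h \<in> ?C" "x \<in> carrier G" for h x
    using that by (simp add: coset_mult_assoc[symmetric] C.subset)
  have cl: "n \<in> carrier G" "m \<in> carrier G" using nmC C.mem_carrier by blast+
  have "?C #> (a \<otimes> b) = (?C #> (n \<otimes> b)) \<otimes>\<^bsub>G Mod ?C\<^esub> (?C #> (m \<otimes> a))"
    unfolding nm(3) using cl a b by (intro C.coset_mult) auto
  also have "\<dots> = ?C #> (b \<otimes> a)"
    unfolding absorb[OF nmC(1) b] absorb[OF nmC(2) a] using a b by (rule C.coset_mult[symmetric, rotated])
  finally have "?C #> (a \<otimes> b) = ?C #> (b \<otimes> a)" .
  then have "commutator a b \<in> ?C" using a b C.coset_commute_iff by simp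
  moreover have "?C \<subseteq> H" using pow by (intro closed_hull_minimal H) auto
  ultimately show ?thesis by blast
qed

text \<open>For \<open>p = 2\<close> the exponent \<open>p (p - 1) / 2 = 1\<close> is not divisible by \<open>p\<close>, so the commutator in
  \<open>coset_mult_pow\<close> must itself vanish. Powerfulness with fourth powers puts commutators into \<open>F 2\<close>,
  one step deeper than expected, and this gain is inherited by all terms of the series.\<close>
lemma commutator_mem_F_two:
  assumes "p = 2" "x \<in> F m" "g \<in> carrier G"
  shows "commutator x g \<in> F (Suc (Suc m))"
  using assms(2,3)
proof (induction m arbitrary: x g)
  case 0
  have "y [^] (4::nat) \<in> F (Suc (Suc 0))" if "y \<in> carrier G" for y
  proof -
    have "p ^ Suc (Suc 0) = 4" using assms(1) by simp
    moreover have "y [^] (p ^ Suc (Suc 0)) \<in> F (0 + Suc (Suc 0))"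
      by (rule pow_pow_mem_F) (simp add: that)
    ultimately show ?thesis by (simp only: add_0)
  qed
  then show ?case
    using 0 F_carrier by (intro powerful_commutator F_subgroup F_closed) (auto simp: assms(1))
next
  case (Suc m)
  interpret N: normal "F (Suc (Suc (Suc m)))" G by (rule F_normal)
  let ?N = "F (Suc (Suc (Suc m)))"
  let ?H = "{h \<in> carrier G. \<forall>g\<in>carrier G. commutator h g \<in> ?N}"
  have "F (Suc m) \<subseteq> ?H"
  proof (rule F_Suc_minimal[OF N.centralizer_mod_subgroup])
    have "?H = (\<Inter>g\<in>carrier G. {h \<in> carrier G. commutator h g \<in> ?N})"
      using one_closed by blast
    also have "closedin T \<dots>"
      unfolding commutator_def
      by (intro closedin_Inter) (auto intro!: closedin_preimage continuous_group_intros F_closed simp del: lower_p_series.simps)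
    finally show "closedin T ?H" .
  next
    fix x g assume x: "x \<in> F m" and g: "g \<in> carrier G"
    have xc: "x \<in> carrier G" using x F_carrier by blast
    show "commutator x g \<in> ?H"
      using Suc.IH[OF x g] commutator_mem_F xc g by blast
  next
    fix x assume x: "x \<in> F m"
    then have xc: "x \<in> carrier G" using F_carrier by blast
    have "commutator (x [^] p) g \<in> ?N" if g: "g \<in> carrier G" for g
    proof -
      let ?v = "commutator x g"
      have v: "?v \<in> F (Suc (Suc m))" by (rule Suc.IH[OF x g])
      have vc: "?v \<in> carrier G" using xc g by simp
      have vx: "commutator ?v x \<in> ?N" by (rule commutator_mem_F[OF v xc])
      have "?N #> ((x \<otimes> ?v) [^] p) = ?N #> (x [^] p \<otimes> ?v [^] p)"
        using commutator_mem_F[OF vx] F_Suc_subset subgroup_nat_pow_closed[OF N.is_subgroup vx]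
        by (intro N.coset_mult_pow xc vc) blast+
      also have "\<dots> = ?N #> (x [^] p)"
        using pow_mem_F[OF v] xc vc by (subst N.coset_eq_iff) blast+
      finally have "?N #> (g \<otimes> (x \<otimes> ?v) [^] p) = ?N #> (g \<otimes> x [^] p)"
        using xc vc g by (simp only: N.coset_mult nat_pow_closed m_closed)
      then have "?N #> (x [^] p \<otimes> g) = ?N #> (g \<otimes> x [^] p)"
        by (simp only: conj_pow_commutator[OF xc g])
      then show ?thesis using N.coset_commute_iff[OF nat_pow_closed[OF xc] g] by blast
    qed
    then show "x [^] p \<in> ?H" using xc by simp
  qed
  then show ?case using Suc.prems by blast
qed

text \<open>The power map induces homomorphisms between successive quotients of the series. The first factor ranges over
  the whole group: this is needed when \<open>c\<close> is a commutator with \<open>b\<close> and lies one step deeper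
  than \<open>b\<close>. For odd \<open>p\<close> the exponent \<open>p (p - 1) / 2\<close> is a multiple of \<open>p\<close>, which kills the commutator.\<close>
lemma pow_mult_mod:
  assumes b: "b \<in> carrier G" and c: "c \<in> F m"
  shows "F (Suc (Suc m)) #> ((b \<otimes> c) [^] p) = F (Suc (Suc m)) #> (b [^] p \<otimes> c [^] p)"
proof -
  interpret N: normal "F (Suc (Suc m))" G by (rule F_normal)
  have cc: "c \<in> carrier G" using c F_carrier by blast
  let ?u = "commutator c b"
  have u: "?u \<in> F (Suc m)" by (rule commutator_mem_F[OF c b])
  show ?thesis
  proof (rule N.coset_mult_pow[OF b cc])
    show "commutator ?u g \<in> F (Suc (Suc m))" if "g \<in> carrier G" for g
      by (rule commutator_mem_F[OF u that])
    show "?u [^] (p * (p - 1) div 2) \<in> F (Suc (Suc m))"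
    proof (cases "p = 2")
      case True
      then show ?thesis using commutator_mem_F_two[OF True c b] b cc by simp
    next
      case False
      then have "odd p" using prime_p prime_odd_nat prime_ge_2_nat by (metis le_neq_implies_less)
      then have "p * (p - 1) div 2 = p * ((p - 1) div 2)" by (simp add: div_mult_swap)
      then have "?u [^] (p * (p - 1) div 2) = (?u [^] p) [^] ((p - 1) div 2)"
        using b cc by (simp add: nat_pow_pow)
      then show ?thesis using pow_mem_F[OF u] subgroup_nat_pow_closed[OF F_subgroup] by metis
    qed
  qed
qed

text \<open>The elements of \<open>F (m + 1)\<close> which are \<open>p\<close>-th powers from \<open>F m\<close> modulo \<open>F (m + 2)\<close>. It will turn
  out to be all of \<open>F (m + 1)\<close>.\<close>
definition pow_image :: "nat \<Rightarrow> 'a set" where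
  "pow_image m = {y \<in> carrier G. \<exists>a\<in>F m. F (Suc (Suc m)) #> y = F (Suc (Suc m)) #> (a [^] p)}"

text \<open>It is the product of the compact set of \<open>p\<close>-th powers with a closed subgroup.\<close>
lemma pow_image_closed: "closedin T (pow_image m)"
proof -
  interpret N: normal "F (Suc (Suc m))" G by (rule F_normal)
  have "pow_image m = ((\<lambda>a. a [^] p) ` F m) <#> F (Suc (Suc m))"
  proof (intro equalityI subsetI)
    fix y assume "y \<in> pow_image m"
    then obtain a where a: "a \<in> F m" "y \<in> carrier G" "F (Suc (Suc m)) #> y = F (Suc (Suc m)) #> (a [^] p)"
      unfolding pow_image_def by blast
    then obtain h where "h \<in> F (Suc (Suc m))" "y = a [^] p \<otimes> h"
      using N.coset_eq_iff[of y "a [^] p"] F_carrier by blast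
    then show "y \<in> ((\<lambda>a. a [^] p) ` F m) <#> F (Suc (Suc m))"
      using a unfolding set_mult_def by blast
  next
    fix y assume "y \<in> ((\<lambda>a. a [^] p) ` F m) <#> F (Suc (Suc m))"
    then obtain a h where ah: "a \<in> F m" "h \<in> F (Suc (Suc m))" "y = a [^] p \<otimes> h"
      unfolding set_mult_def by blast
    moreover have "a \<in> carrier G" "h \<in> carrier G" using ah F_carrier by blast+
    ultimately show "y \<in> pow_image m"
      using N.coset_eq_iff[of y "a [^] p"] unfolding pow_image_def by blast
  qed
  also have "closedin T \<dots>"
    by (intro closedin_set_mult closedin_image F_closed continuous_group_intros)
  finally show ?thesis .
qed

lemma pow_mem_pow_image: "a \<in> F m \<Longrightarrow> a [^] p \<in> pow_image m"
  using F_carrier unfolding pow_image_def by blast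

lemma pow_image_subgroup: "subgroup (pow_image m) G"
proof (rule subgroupI)
  interpret N: normal "F (Suc (Suc m))" G by (rule F_normal)
  interpret S: subgroup "F m" G by (rule F_subgroup)
  show "pow_image m \<noteq> {}" using pow_mem_pow_image S.one_closed by blast
  fix y assume "y \<in> pow_image m"
  then obtain a where a: "a \<in> F m" "y \<in> carrier G" "F (Suc (Suc m)) #> y = F (Suc (Suc m)) #> (a [^] p)"
    unfolding pow_image_def by blast
  have "F (Suc (Suc m)) #> inv y = F (Suc (Suc m)) #> inv (a [^] p)"
    using a by (metis N.rcos_inv S.mem_carrier nat_pow_closed)
  moreover have "inv (a [^] p) = (inv a) [^] p" using a by (simp add: nat_pow_inv)
  ultimately show "inv y \<in> pow_image m"
    using a S.m_inv_closed unfolding pow_image_def by auto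
  fix z assume "z \<in> pow_image m"
  then obtain b where b: "b \<in> F m" "z \<in> carrier G" "F (Suc (Suc m)) #> z = F (Suc (Suc m)) #> (b [^] p)"
    unfolding pow_image_def by blast
  have "F (Suc (Suc m)) #> (y \<otimes> z) = F (Suc (Suc m)) #> (a [^] p \<otimes> b [^] p)"
    using a b by (simp add: N.coset_mult del: lower_p_series.simps)
  also have "\<dots> = F (Suc (Suc m)) #> ((a \<otimes> b) [^] p)"
    using pow_mult_mod[OF S.mem_carrier[OF a(1)] b(1)] by simp
  finally show "y \<otimes> z \<in> pow_image m"
    using a b S.m_closed unfolding pow_image_def by blast
qed (auto simp: pow_image_def)

text \<open>For \<open>m = 0\<close> this is powerfulness. In the inductive step \<open>a\<close> may be replaced by a power \<open>b\<^sup>p\<close> with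
  \<open>b\<close> in \<open>F m\<close>, and \<open>[b\<^sup>p, g]\<close> is congruent to \<open>[b, g]\<^sup>p\<close> because \<open>g\<^sup>-\<^sup>1 b g = b [b, g]\<close> and the power map is
  additive by \<open>pow_mult_mod\<close>.\<close>
lemma commutator_mem_pow_image:
  assumes "a \<in> F m" "g \<in> carrier G"
  shows "commutator a g \<in> pow_image m"
  using assms
proof (induction m arbitrary: a g)
  case 0
  have "x [^] (if p = 2 then 4 else p) \<in> pow_image 0" if x: "x \<in> carrier G" for x
  proof (cases "p = 2")
    case True
    have "(x [^] p) [^] p \<in> pow_image 0" using pow_mem_pow_image[of "x [^] p" 0] x by simp
    then show ?thesis using x True by (simp add: nat_pow_pow)
  next
    case False
    then show ?thesis using pow_mem_pow_image[of x 0] x by simp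
  qed
  then show ?case
    using 0 F_carrier by (intro powerful_commutator pow_image_subgroup pow_image_closed) auto
next
  case (Suc m)
  define N where "N = F (Suc (Suc (Suc m)))"
  interpret N: normal N G unfolding N_def by (rule F_normal)
  interpret Q: group "G Mod N" by (rule N.factorgroup_is_group)
  let ?\<phi> = "\<lambda>x. N #> x"
  have "F (Suc m) \<subseteq> pow_image m"
    by (rule F_Suc_minimal[OF pow_image_subgroup pow_image_closed pow_mem_pow_image])
      (use Suc.IH in auto)
  then obtain b where b: "b \<in> F m" and ab: "F (Suc (Suc m)) #> a = F (Suc (Suc m)) #> (b [^] p)"
    using Suc.prems unfolding pow_image_def by blast
  have ac: "a \<in> carrier G" and bc: "b \<in> carrier G" and g: "g \<in> carrier G"
    using Suc.prems b F_carrier by blast+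
  obtain z where z: "z \<in> F (Suc (Suc m))" "a = b [^] p \<otimes> z"
    using ab ac bc normal.coset_eq_iff[OF F_normal, of a "b [^] p" "Suc (Suc m)"] by blast
  have zc: "z \<in> carrier G" using z F_carrier by blast
  let ?c = "commutator b g"
  have c: "?c \<in> F (Suc m)" by (rule commutator_mem_F[OF b g])
  have cc: "?c \<in> carrier G" using bc g by simp
  have "commutator z h \<in> N" if "h \<in> carrier G" for h
    unfolding N_def by (rule commutator_mem_F[OF z(1) that])
  then have zcomm: "?\<phi> z \<otimes>\<^bsub>G Mod N\<^esub> ?\<phi> h = ?\<phi> h \<otimes>\<^bsub>G Mod N\<^esub> ?\<phi> z" if "h \<in> carrier G" for h
    using that zc by (subst N.coset_mult_commute_iff) auto
  have "b [^] p \<otimes> g = g \<otimes> (b \<otimes> ?c) [^] p" using conj_pow_commutator[OF bc g] by simp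
  then have "?\<phi> (b [^] p) \<otimes>\<^bsub>G Mod N\<^esub> ?\<phi> g = ?\<phi> g \<otimes>\<^bsub>G Mod N\<^esub> ?\<phi> ((b \<otimes> ?c) [^] p)"
    using bc cc g by (metis N.coset_mult m_closed nat_pow_closed)
  also have "?\<phi> ((b \<otimes> ?c) [^] p) = ?\<phi> (b [^] p) \<otimes>\<^bsub>G Mod N\<^esub> ?\<phi> (?c [^] p)"
    using pow_mult_mod[OF bc c] bc cc N.coset_mult unfolding N_def by (metis nat_pow_closed)
  finally have bg: "?\<phi> (b [^] p) \<otimes>\<^bsub>G Mod N\<^esub> ?\<phi> g
      = ?\<phi> g \<otimes>\<^bsub>G Mod N\<^esub> (?\<phi> (b [^] p) \<otimes>\<^bsub>G Mod N\<^esub> ?\<phi> (?c [^] p))" .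
  have \<phi>a: "?\<phi> a = ?\<phi> (b [^] p) \<otimes>\<^bsub>G Mod N\<^esub> ?\<phi> z"
    using z bc zc N.coset_mult by blast
  note cl = N.coset_carrier[OF nat_pow_closed[OF bc, of p]] N.coset_carrier[OF zc]
    N.coset_carrier[OF g] N.coset_carrier[OF nat_pow_closed[OF cc, of p]] N.coset_carrier[OF ac]
    N.coset_carrier[OF commutator_closed[OF ac g]]
  have "?\<phi> a \<otimes>\<^bsub>G Mod N\<^esub> ?\<phi> g = ?\<phi> (b [^] p) \<otimes>\<^bsub>G Mod N\<^esub> (?\<phi> z \<otimes>\<^bsub>G Mod N\<^esub> ?\<phi> g)"
    unfolding \<phi>a using cl by (simp add: Q.m_assoc del: mult_FactGroup)
  also have "\<dots> = (?\<phi> (b [^] p) \<otimes>\<^bsub>G Mod N\<^esub> ?\<phi> g) \<otimes>\<^bsub>G Mod N\<^esub> ?\<phi> z"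
    unfolding zcomm[OF g] using cl by (simp add: Q.m_assoc del: mult_FactGroup)
  also have "\<dots> = ?\<phi> g \<otimes>\<^bsub>G Mod N\<^esub> (?\<phi> (b [^] p) \<otimes>\<^bsub>G Mod N\<^esub> (?\<phi> (?c [^] p) \<otimes>\<^bsub>G Mod N\<^esub> ?\<phi> z))"
    unfolding bg using cl by (simp add: Q.m_assoc del: mult_FactGroup)
  also have "?\<phi> (?c [^] p) \<otimes>\<^bsub>G Mod N\<^esub> ?\<phi> z = ?\<phi> z \<otimes>\<^bsub>G Mod N\<^esub> ?\<phi> (?c [^] p)"
    using zcomm cc by simp
  also have "?\<phi> g \<otimes>\<^bsub>G Mod N\<^esub> (?\<phi> (b [^] p) \<otimes>\<^bsub>G Mod N\<^esub> (?\<phi> z \<otimes>\<^bsub>G Mod N\<^esub> ?\<phi> (?c [^] p)))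
      = (?\<phi> g \<otimes>\<^bsub>G Mod N\<^esub> ?\<phi> a) \<otimes>\<^bsub>G Mod N\<^esub> ?\<phi> (?c [^] p)"
    unfolding \<phi>a using cl by (simp add: Q.m_assoc del: mult_FactGroup)
  finally have 1: "?\<phi> a \<otimes>\<^bsub>G Mod N\<^esub> ?\<phi> g = (?\<phi> g \<otimes>\<^bsub>G Mod N\<^esub> ?\<phi> a) \<otimes>\<^bsub>G Mod N\<^esub> ?\<phi> (?c [^] p)" .
  have 2: "?\<phi> a \<otimes>\<^bsub>G Mod N\<^esub> ?\<phi> g = (?\<phi> g \<otimes>\<^bsub>G Mod N\<^esub> ?\<phi> a) \<otimes>\<^bsub>G Mod N\<^esub> ?\<phi> (commutator a g)"
    using mult_commutator[OF ac g] ac g commutator_closed[OF ac g] by (metis N.coset_mult m_closed)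
  have "?\<phi> (commutator a g) = ?\<phi> (?c [^] p)"
    using 1 2 cl by (metis Q.Units_eq Q.Units_l_cancel Q.m_closed)
  then show ?case using c ac g unfolding pow_image_def N_def by blast
qed

lemma F_Suc_subset_pow_image: "F (Suc m) \<subseteq> pow_image m"
  by (rule F_Suc_minimal[OF pow_image_subgroup pow_image_closed pow_mem_pow_image
        commutator_mem_pow_image])

end

section \<open>Finitely generated powerful pro-\<open>p\<close> groups\<close>

locale fg_powerful_pro_p = powerful_pro_p +
  fixes xs :: "'a list"
  assumes gens_carrier: "set xs \<subseteq> carrier G"
    and gens_dense: "T closure_of (generate G (set xs)) = carrier G"
begin

text \<open>The exponents are bounded so that only finitely many products arise. They suffice because the quotients of the
  series have exponent \<open>p\<close>.\<close>
definition bounded_powers :: "'a \<Rightarrow> 'a set" where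
  "bounded_powers y = (\<lambda>e. y [^] e) ` {..<p}"

text \<open>Representatives of \<open>F k\<close> modulo \<open>F (k + 1)\<close>, see \<open>level_products_F_Suc\<close>.\<close>
abbreviation level_products :: "nat \<Rightarrow> 'a set" where
  "level_products k \<equiv> list_set_mult (\<lambda>x. bounded_powers (x [^] (p ^ k))) xs"

lemma gen_carrier: "x \<in> set xs \<Longrightarrow> x \<in> carrier G"
  using gens_carrier by blast

lemma bounded_powers_F:
  assumes "x \<in> set xs"
  shows "bounded_powers (x [^] (p ^ k)) \<subseteq> F k"
proof -
  have "x [^] (p ^ k) \<in> F (0 + k)"
    by (rule pow_pow_mem_F) (simp add: gen_carrier assms)
  then show ?thesis
    unfolding bounded_powers_def using subgroup_nat_pow_closed[OF F_subgroup] by auto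
qed

lemma bounded_powers_carrier:
  "x \<in> set xs \<Longrightarrow> bounded_powers (x [^] (p ^ k)) \<subseteq> carrier G"
  using bounded_powers_F F_carrier by blast

lemma p_pos: "p > 0"
  using prime_gt_0_nat[OF prime_p] .

lemma level_products_F: "level_products k \<subseteq> F k"
  by (rule list_set_mult_subgroup[OF F_subgroup bounded_powers_F])

lemma one_level_products: "\<one> \<in> level_products k"
proof (rule list_set_mult_one)
  fix x
  have "\<one> = (x [^] (p ^ k)) [^] (0::nat)" by simp
  then show "\<one> \<in> bounded_powers (x [^] (p ^ k))"
    unfolding bounded_powers_def using p_pos by blast
qed

lemma finite_level_products: "finite (level_products k)"
  by (rule list_set_mult_finite) (simp add: bounded_powers_def)

text \<open>Modulo \<open>F 1\<close> the group is abelian of exponent \<open>p\<close>, so the products form a subgroup. It contains the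
  generators, and it is closed, being a finite union of cosets of \<open>F 1\<close>.\<close>
lemma level_products_F_0:
  assumes "g \<in> carrier G"
  shows "\<exists>b\<in>level_products 0. F 1 #> g = F 1 #> b"
proof -
  define N where "N = F 1"
  interpret N: normal N G unfolding N_def by (rule F_normal)
  let ?E = "{g \<in> carrier G. \<exists>b\<in>level_products 0. N #> g = N #> b}"
  have powN: "x [^] p \<in> N" if "x \<in> carrier G" for x
    using pow_mem_F[of x 0] that by (simp add: N_def)
  have commN: "commutator x y \<in> N" if "x \<in> carrier G" "y \<in> carrier G" for x y
    using commutator_mem_F[of x 0 y] that by (simp add: N_def)
  have Dc: "level_products 0 \<subseteq> carrier G" using level_products_F F_carrier by blast
  have mult: "\<exists>c\<in>level_products 0. N #> (a \<otimes> b) = N #> c"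
    if "a \<in> level_products 0" "b \<in> level_products 0" for a b
  proof (rule N.list_set_mult_absorb_central[OF _ _ _ _ _ that])
    fix x a b assume x: "x \<in> set xs"
      and "a \<in> bounded_powers (x [^] (p ^ 0))" "b \<in> bounded_powers (x [^] (p ^ 0))"
    then obtain i j where ij: "a = x [^] (i::nat)" "b = x [^] (j::nat)"
      using gen_carrier[OF x] unfolding bounded_powers_def by auto
    have xc: "x \<in> carrier G" using gen_carrier[OF x] .
    \<comment> \<open>Exponents may be reduced modulo \<open>p\<close>.\<close>
    let ?r = "(i + j) mod p" and ?q = "(i + j) div p"
    have "a \<otimes> b = x [^] ?r \<otimes> (x [^] p) [^] ?q"
      unfolding ij using xc by (simp add: nat_pow_mult nat_pow_pow)
    moreover have "(x [^] p) [^] ?q \<in> N"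
      using subgroup_nat_pow_closed[OF N.is_subgroup powN[OF xc]] .
    ultimately have "N #> (a \<otimes> b) = N #> (x [^] ?r)"
      using xc by (subst N.coset_eq_iff) auto
    moreover have "x [^] ?r \<in> bounded_powers (x [^] (p ^ 0))"
      unfolding bounded_powers_def using xc p_pos by auto
    ultimately show "\<exists>c\<in>bounded_powers (x [^] (p ^ 0)). N #> (a \<otimes> b) = N #> c" by blast
  qed (use bounded_powers_carrier commN in blast)+
  have multE: "a \<otimes> b \<in> ?E" if "a \<in> ?E" "b \<in> ?E" for a b
  proof -
    obtain a' b' where a': "a' \<in> level_products 0" "N #> a = N #> a'"
      and b': "b' \<in> level_products 0" "N #> b = N #> b'"
      using \<open>a \<in> ?E\<close> \<open>b \<in> ?E\<close> by blast
    have c: "a \<in> carrier G" "b \<in> carrier G" "a' \<in> carrier G" "b' \<in> carrier G"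
      using that a' b' Dc by blast+
    have "N #> (a \<otimes> b) = N #> (a' \<otimes> b')"
      by (simp only: N.coset_mult c a' b')
    with mult[OF a'(1) b'(1)] c show ?thesis by auto
  qed
  have oneE: "\<one> \<in> ?E" using one_level_products by blast
  have "subgroup ?E G"
  proof (rule subgroupI)
    show "?E \<noteq> {}" using oneE by blast
    fix a assume a: "a \<in> ?E"
    have pE: "a [^] n \<in> ?E" for n :: nat
      by (induction n) (use oneE multE a in auto)
    have ac: "a \<in> carrier G" using a by blast
    obtain n where n: "p = Suc n" using p_pos by (cases p) auto
    \<comment> \<open>Inverses are powers because the quotient has exponent \<open>p\<close>.\<close>
    have "inv a = a [^] n \<otimes> inv (a [^] p)"
      unfolding n nat_pow_Suc2[OF ac] using ac by (simp add: inv_mult_group m_assoc[symmetric])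
    then have "N #> inv a = N #> (a [^] n)"
      using ac powN[OF ac] by (subst N.coset_eq_iff) auto
    then show "inv a \<in> ?E" using pE[of n] ac by auto
  qed (use multE in auto)
  moreover have "set xs \<subseteq> ?E"
  proof
    fix x assume x: "x \<in> set xs"
    have xc: "x \<in> carrier G" using gen_carrier[OF x] .
    have "p > 1" using prime_gt_1_nat[OF prime_p] .
    then have "x \<in> bounded_powers (x [^] (p ^ 0))"
      unfolding bounded_powers_def using xc by (auto intro!: image_eqI[of _ _ 1])
    moreover have "\<one> \<in> bounded_powers (y [^] (p ^ 0))" for y
      unfolding bounded_powers_def using p_pos by (auto intro!: image_eqI[of _ _ 0])
    ultimately have "x \<in> level_products 0"
      using bounded_powers_carrier by (intro list_set_mult_factor[OF x]) blast+
    then show "x \<in> ?E" using xc by blast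
  qed
  ultimately have "generate G (set xs) \<subseteq> ?E"
    using generate_subgroup_incl by blast
  moreover have "closedin T ?E"
  proof -
    have "?E = level_products 0 <#> N"
    proof (intro equalityI subsetI)
      fix y assume "y \<in> ?E"
      then obtain b where b: "b \<in> level_products 0" "y \<in> carrier G" "N #> y = N #> b" by blast
      then obtain h where "h \<in> N" "y = b \<otimes> h" using N.coset_eq_iff[of y b] Dc by blast
      then show "y \<in> level_products 0 <#> N" using b(1) unfolding set_mult_def by blast
    next
      fix y assume "y \<in> level_products 0 <#> N"
      then obtain b h where bh: "b \<in> level_products 0" "h \<in> N" "y = b \<otimes> h"
        unfolding set_mult_def by blast
      then have "b \<in> carrier G" "y \<in> carrier G" using Dc by auto
      then show "y \<in> ?E" using bh N.coset_eq_iff[of y b] by blast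
    qed
    moreover have "closedin T N" unfolding N_def by (rule F_closed)
    ultimately show ?thesis
      using closedin_finite[OF finite_level_products Dc] closedin_set_mult by simp
  qed
  ultimately have "T closure_of (generate G (set xs)) \<subseteq> ?E"
    by (rule closure_of_minimal)
  then show ?thesis using assms unfolding gens_dense N_def by blast
qed

lemma pow_list_set_mult_mod:
  assumes "set ys \<subseteq> set xs" "b \<in> list_set_mult (\<lambda>x. bounded_powers (x [^] (p ^ k))) ys"
  shows "\<exists>b'\<in>list_set_mult (\<lambda>x. bounded_powers (x [^] (p ^ Suc k))) ys.
    F (Suc (Suc k)) #> (b [^] p) = F (Suc (Suc k)) #> b'"
  using assms
proof (induction ys arbitrary: b)
  case (Cons y ys)
  define N where "N = F (Suc (Suc k))"
  interpret N: normal N G unfolding N_def by (rule F_normal)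
  obtain b1 b2 where b: "b = b1 \<otimes> b2" "b1 \<in> bounded_powers (y [^] (p ^ k))"
    "b2 \<in> list_set_mult (\<lambda>x. bounded_powers (x [^] (p ^ k))) ys"
    using Cons.prems by (auto simp: set_mult_def)
  obtain c where c: "c \<in> list_set_mult (\<lambda>x. bounded_powers (x [^] (p ^ Suc k))) ys"
    "N #> (b2 [^] p) = N #> c"
    using Cons.IH[OF _ b(3)] Cons.prems unfolding N_def by auto
  have y: "y \<in> set xs" "y \<in> carrier G" using Cons.prems gen_carrier by auto
  have ys: "x \<in> set xs" if "x \<in> set ys" for x using that Cons.prems by auto
  have b1: "b1 \<in> carrier G" using bounded_powers_carrier[OF y(1)] b by blast
  have b2: "b2 \<in> F k"
    using list_set_mult_subgroup[OF F_subgroup, of ys "\<lambda>x. bounded_powers (x [^] (p ^ k))" k]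
      bounded_powers_F ys b(3) by blast
  have b2c: "b2 \<in> carrier G" using b2 F_carrier by blast
  have cc: "c \<in> carrier G"
    using list_set_mult_carrier[of ys "\<lambda>x. bounded_powers (x [^] (p ^ Suc k))"]
      bounded_powers_carrier ys c(1) by blast
  obtain e where e: "e < p" "b1 = (y [^] (p ^ k)) [^] e"
    using b(2) unfolding bounded_powers_def by blast
  have "b1 [^] p = (y [^] (p ^ Suc k)) [^] e"
    using y e by (simp add: nat_pow_pow mult_ac)
  then have b1p: "b1 [^] p \<in> bounded_powers (y [^] (p ^ Suc k))"
    using e unfolding bounded_powers_def by blast
  have "N #> (b [^] p) = N #> (b1 [^] p \<otimes> b2 [^] p)"
    unfolding b(1) N_def by (rule pow_mult_mod[OF b1 b2])
  also have "\<dots> = N #> (b1 [^] p \<otimes> c)"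
    using b1 b2c cc c(2) by (simp only: N.coset_mult nat_pow_closed)
  finally show ?case using b1p c(1) unfolding N_def list_set_mult_simps set_mult_def by blast
qed simp

text \<open>Apply the power map to representatives one level higher, using that it is surjective between the
  successive quotients.\<close>
lemma level_products_F_Suc:
  "g \<in> F k \<Longrightarrow> \<exists>b\<in>level_products k. F (Suc k) #> g = F (Suc k) #> b"
proof (induction k arbitrary: g)
  case 0
  then show ?case using level_products_F_0 by simp
next
  case (Suc k)
  define N where "N = F (Suc (Suc k))"
  interpret N: normal N G unfolding N_def by (rule F_normal)
  obtain a where a: "a \<in> F k" "N #> g = N #> (a [^] p)"
    using F_Suc_subset_pow_image Suc.prems unfolding pow_image_def N_def by blast
  obtain b where b: "b \<in> level_products k" "F (Suc k) #> a = F (Suc k) #> b"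
    using Suc.IH[OF a(1)] by blast
  have ac: "a \<in> carrier G" and bc: "b \<in> carrier G"
    using a b level_products_F F_carrier by blast+
  obtain w where w: "w \<in> F (Suc k)" "a = b \<otimes> w"
    using normal.coset_eq_iff[OF F_normal ac bc] b(2) by blast
  have wF: "w \<in> F k" and wc: "w \<in> carrier G" using w F_Suc_subset F_carrier by blast+
  have "w [^] p \<in> N" unfolding N_def by (rule pow_mem_F[OF w(1)])
  then have "N #> (b [^] p \<otimes> w [^] p) = N #> (b [^] p)"
    using bc wc by (subst N.coset_eq_iff) auto
  moreover have "N #> (a [^] p) = N #> (b [^] p \<otimes> w [^] p)"
    unfolding w(2) N_def by (rule pow_mult_mod[OF bc wF])
  moreover obtain b' where "b' \<in> level_products (Suc k)" "N #> (b [^] p) = N #> b'"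
    using pow_list_set_mult_mod[OF _ b(1)] unfolding N_def by blast
  ultimately show ?case using a(2) unfolding N_def by auto
qed

lemma F_finite_representatives:
  "\<exists>S. finite S \<and> S \<subseteq> carrier G \<and> (\<forall>g\<in>carrier G. \<exists>s\<in>S. F k #> g = F k #> s)"
proof (induction k)
  case 0
  have "F 0 #> g = F 0 #> \<one>" if "g \<in> carrier G" for g
    using that coset_join2[OF that subgroup_self] by simp
  then show ?case by (intro exI[of _ "{\<one>}"]) auto
next
  case (Suc k)
  then obtain S where S: "finite S" "S \<subseteq> carrier G" "\<forall>g\<in>carrier G. \<exists>s\<in>S. F k #> g = F k #> s"
    by blast
  interpret N: normal "F k" G by (rule F_normal)
  interpret N': normal "F (Suc k)" G by (rule F_normal)
  have Dc: "level_products k \<subseteq> carrier G" using level_products_F F_carrier by blast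
  have "\<exists>t\<in>S <#> level_products k. F (Suc k) #> g = F (Suc k) #> t" if g: "g \<in> carrier G" for g
  proof -
    obtain s where s: "s \<in> S" "F k #> g = F k #> s" using S(3) g by blast
    have sc: "s \<in> carrier G" using s S by blast
    obtain f where f: "f \<in> F k" "g = s \<otimes> f" using N.coset_eq_iff[OF g sc] s by blast
    have fc: "f \<in> carrier G" using f F_carrier by blast
    obtain b where b: "b \<in> level_products k" "F (Suc k) #> f = F (Suc k) #> b"
      using level_products_F_Suc[OF f(1)] by blast
    have bc: "b \<in> carrier G" using b Dc by blast
    have "F (Suc k) #> g = F (Suc k) #> (s \<otimes> b)"
      unfolding f(2) by (simp only: N'.coset_mult sc fc bc b(2))
    then show ?thesis using s b unfolding set_mult_def by blast
  qed
  moreover have "finite (S <#> level_products k)"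
    using S(1) finite_level_products by (auto simp: set_mult_def)
  moreover have "S <#> level_products k \<subseteq> carrier G" using S(2) Dc by (rule set_mult_closed)
  ultimately show ?case by blast
qed

text \<open>The successive quotients are finite, so \<open>F k\<close> is a closed subgroup of finite index.\<close>
lemma F_open: "openin T (F k)"
proof (rule closed_subgroup_open_of_finite_index[OF F_subgroup F_closed])
  obtain S where S: "finite S" "\<forall>g\<in>carrier G. \<exists>s\<in>S. F k #> g = F k #> s"
    using F_finite_representatives by blast
  have "rcosets F k \<subseteq> (\<lambda>s. F k #> s) ` S" using S(2) by (auto simp: RCOSETS_def)
  then show "finite (rcosets F k)" using S(1) finite_surj by blast
qed

text \<open>Successive approximation: an error in \<open>F (n + k)\<close> is corrected modulo \<open>F (n + k + 1)\<close> by powers of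
  the generators of the procyclic factors. These are central modulo \<open>F (n + k + 1)\<close>, so each can be absorbed into
  its own factor. The product of the factors is closed, hence contains the limit.\<close>
lemma F_subset_procyclic_product:
  "F n \<subseteq> list_set_mult (\<lambda>x. closed_hull {x [^] (p ^ n)}) xs"
proof
  let ?A = "\<lambda>x. closed_hull {x [^] (p ^ n)}"
  let ?P = "list_set_mult ?A xs"
  fix g assume g: "g \<in> F n"
  have gc: "g \<in> carrier G" using g F_carrier by blast
  have A_sub: "subgroup (?A x) G" if "x \<in> set xs" for x
    using gen_carrier[OF that] by (intro closed_hull_subgroup) auto
  have Ac: "?A x \<subseteq> carrier G" if "x \<in> set xs" for x
    using subgroup.subset[OF A_sub[OF that]] .
  have Pc: "?P \<subseteq> carrier G" by (rule list_set_mult_carrier[OF Ac])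
  have approx: "\<exists>a\<in>?P. F (n + k) #> g = F (n + k) #> a" for k
  proof (induction k)
    case 0
    interpret N: normal "F n" G by (rule F_normal)
    have "\<one> \<in> ?P" using subgroup.one_closed[OF A_sub] by (rule list_set_mult_one)
    moreover have "F n #> g = F n #> \<one>"
      using g N.coset_of_mem N.one_closed by metis
    ultimately show ?case unfolding add_0_right by blast
  next
    case (Suc k)
    then obtain a where a: "a \<in> ?P" "F (n + k) #> g = F (n + k) #> a" by blast
    define N where "N = F (Suc (n + k))"
    interpret N: normal N G unfolding N_def by (rule F_normal)
    have ac: "a \<in> carrier G" using a Pc by blast
    obtain f where f: "f \<in> F (n + k)" "g = a \<otimes> f"
      using normal.coset_eq_iff[OF F_normal gc ac] a(2) by blast
    have fc: "f \<in> carrier G" using f F_carrier by blast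
    obtain b where b: "b \<in> level_products (n + k)" "N #> f = N #> b"
      using level_products_F_Suc[OF f(1)] unfolding N_def by blast
    have bc: "b \<in> carrier G" using b level_products_F F_carrier by blast
    have "\<exists>c\<in>?P. N #> (a \<otimes> b) = N #> c"
    proof (rule N.list_set_mult_absorb_central[OF Ac bounded_powers_carrier Ac _ _ a(1) b(1)])
      show "commutator y h \<in> N"
        if "x \<in> set xs" "y \<in> bounded_powers (x [^] (p ^ (n + k)))" "h \<in> carrier G" for x y h
        unfolding N_def using that bounded_powers_F by (intro commutator_mem_F) blast+
      fix x u v assume x: "x \<in> set xs" and u: "u \<in> ?A x"
        and v: "v \<in> bounded_powers (x [^] (p ^ (n + k)))"
      obtain e where "v = (x [^] (p ^ (n + k))) [^] (e::nat)"
        using v unfolding bounded_powers_def by blast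
      then have "v = (x [^] (p ^ n)) [^] (p ^ k * e)"
        using gen_carrier[OF x] by (simp add: nat_pow_pow power_add mult_ac)
      moreover have "x [^] (p ^ n) \<in> ?A x" using closed_hull_incl by blast
      ultimately have "v \<in> ?A x" using subgroup_nat_pow_closed[OF A_sub[OF x]] by simp
      then have "u \<otimes> v \<in> ?A x" using u subgroup.m_closed[OF A_sub[OF x]] by blast
      then show "\<exists>c\<in>?A x. N #> (u \<otimes> v) = N #> c" by blast
    qed
    moreover have "N #> g = N #> (a \<otimes> b)"
      unfolding f(2) by (simp only: N.coset_mult ac fc bc b(2))
    ultimately show ?case unfolding N_def by auto
  qed
  show "g \<in> ?P"
  proof (rule mem_closed_of_approx[OF _ gc])
    show "closedin T ?P"
      using gen_carrier by (intro list_set_mult_closed closed_hull_closed) auto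
    fix k
    obtain a where a: "a \<in> ?P" "F (n + k) #> g = F (n + k) #> a" using approx by blast
    have ac: "a \<in> carrier G" using a Pc by blast
    obtain h where "h \<in> F (n + k)" "g = a \<otimes> h"
      using normal.coset_eq_iff[OF F_normal gc ac] a(2) by blast
    moreover have "F (n + k) \<subseteq> F k" by (rule F_antimono) simp
    ultimately have "F k #> g = F k #> a"
      using normal.coset_eq_iff[OF F_normal gc ac] by blast
    then show "\<exists>q\<in>?P. F k #> g = F k #> q" using a by blast
  qed
qed

text \<open>Nothing topological is known about \<open>S\<close>: it contains an open subgroup because it is closed under the finite products of
  \<open>F_subset_procyclic_product\<close>.\<close>
lemma subgroup_contains_F:
  assumes S: "subgroup S G" and N: "N > 0"
    and cyc: "\<And>x. x \<in> set xs \<Longrightarrow> closed_hull {x [^] (N::nat)} \<subseteq> S"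
  shows "\<exists>n. F n \<subseteq> S"
proof -
  \<comment> \<open>Split off the part of \<open>N\<close> prime to \<open>p\<close>, which does not change the closed hulls.\<close>
  define n where "n = multiplicity p N"
  obtain m where m: "N = p ^ n * m" "\<not> p dvd m"
    using N prime_gt_1_nat[OF prime_p] multiplicity_decompose'[of N p] unfolding n_def
    by (metis nat_dvd_1_iff_1 less_irrefl less_numeral_extra(3))
  have coprime: "coprime m p" "m > 0"
    using m N prime_p by (metis coprime_commute prime_imp_coprime, cases m, auto)
  have "closed_hull {x [^] (p ^ n)} \<subseteq> S" if x: "x \<in> set xs" for x
  proof -
    have xc: "x \<in> carrier G" using gen_carrier[OF x] .
    have "closed_hull {x [^] (p ^ n)} \<subseteq> closed_hull {x [^] N}"
      using mem_closed_hull_coprime_pow[of "x [^] (p ^ n)" m] coprime xc m(1)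
      by (intro closed_hull_minimal closed_hull_subgroup closed_hull_closed) (auto simp: nat_pow_pow)
    then show ?thesis using cyc[OF x] by blast
  qed
  then have "list_set_mult (\<lambda>x. closed_hull {x [^] (p ^ n)}) xs \<subseteq> S"
    by (rule list_set_mult_subgroup[OF S])
  then show ?thesis using F_subset_procyclic_product by blast
qed

end

section \<open>Abstract cocycles on pro-\<open>p\<close> groups\<close>

context representation
begin

lemma add_pow_smult:
  assumes w: "w \<in> carrier V"
  shows "[n] \<cdot>\<^bsub>V\<^esub> w = ([(n::nat)] \<cdot>\<^bsub>K\<^esub> \<one>\<^bsub>K\<^esub>) \<odot>\<^bsub>V\<^esub> w"
proof (induction n)
  case 0
  then show ?case using w by (simp add: V.smult_l_null)
next
  case (Suc n)
  then show ?case
    using w by (simp add: V.smult_l_distr V.smult_one)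
qed

text \<open>A cocycle is additive on the powers of \<open>g\<close> when \<open>g\<close> fixes its value.\<close>
lemma act_pow_add:
  assumes "g \<in> carrier G" "y \<in> carrier V" "w \<in> carrier V"
    and "act V g y = y \<oplus>\<^bsub>V\<^esub> w" "act V g w = w"
  shows "act V (g [^]\<^bsub>G\<^esub> (n::nat)) y = y \<oplus>\<^bsub>V\<^esub> [n] \<cdot>\<^bsub>V\<^esub> w"
proof (induction n)
  case 0
  then show ?case using assms by (simp add: act_one)
next
  case (Suc n)
  have "act V (g [^]\<^bsub>G\<^esub> n) w = w"
    by (induction n) (use assms act_one act_mult in auto)
  then show ?case
    using assms Suc by (simp add: act_mult act_add V.M.a_ac)
qed

lemma stabilizer_subgroup:
  assumes "y \<in> carrier V"
  shows "subgroup {g \<in> carrier G. act V g y = y} G"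
proof (rule G.subgroupI)
  show "{g \<in> carrier G. act V g y = y} \<noteq> {}" using assms act_one by auto
  fix a assume a: "a \<in> {g \<in> carrier G. act V g y = y}"
  then have "act V (inv\<^bsub>G\<^esub> a) y = act V (inv\<^bsub>G\<^esub> a) (act V a y)" by (metis (mono_tags) mem_Collect_eq)
  also have "\<dots> = act V (inv\<^bsub>G\<^esub> a \<otimes>\<^bsub>G\<^esub> a) y" using a assms by (intro act_mult[symmetric]) auto
  also have "\<dots> = y" using a assms by (simp add: act_one)
  finally show "inv\<^bsub>G\<^esub> a \<in> {g \<in> carrier G. act V g y = y}" using a by simp
  fix b assume "b \<in> {g \<in> carrier G. act V g y = y}"
  then show "a \<otimes>\<^bsub>G\<^esub> b \<in> {g \<in> carrier G. act V g y = y}" using a assms by (simp add: act_mult)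
qed auto

lemma restrict_to_subgroup:
  assumes "subgroup U G"
  shows "representation (G\<lparr>carrier := U\<rparr>) K V"
proof (intro representation.intro representation_axioms.intro)
  show "group (G\<lparr>carrier := U\<rparr>)" by (rule G.subgroup_imp_group[OF assms])
  show "field K" by (rule K.field_axioms)
  show "module K V" by (rule V.module_axioms)
qed (use subgroup.mem_carrier[OF assms] act_closed act_add act_smult act_one act_mult in auto)

end

text \<open>Some \<open>F k\<close> is contained in \<open>W\<close>, and \<open>p\<^sup>k\<close>-th powers lie in \<open>F k\<close>.\<close>
lemma (in pro_p) open_contains_pow:
  assumes "openin T W" "\<one> \<in> W" "x \<in> carrier G"
  obtains r where "r > 0" "x [^] (r::nat) \<in> W"
proof -
  obtain k where "F k \<subseteq> W" using F_basis assms by blast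
  moreover have "x [^] (p ^ k) \<in> F (0 + k)" by (rule pow_pow_mem_F) (simp add: assms)
  moreover have "p ^ k > 0" using prime_gt_0_nat[OF prime_p] by simp
  ultimately show thesis using that[of "p ^ k"] by (metis add_0 subsetD)
qed

text \<open>The abstract cocycle \<open>gy - y\<close> vanishes on the closed subgroup generated by some power of \<open>x\<close>, limits
  of powers included. The argument uses two torsion steps: one to reach a power \<open>s\<close> that fixes \<open>y\<close>, and
  one for the elements of the closed hull of \<open>s\<close>.\<close>
lemma (in pro_p) procyclic_stabilizes:
  fixes M :: "('k, 'v, 'a) repn" and l :: nat
  assumes rep: "representation G K M"
    and l: "l > 0" "[l] \<cdot>\<^bsub>K\<^esub> \<one>\<^bsub>K\<^esub> = \<zero>\<^bsub>K\<^esub>"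
    and y: "y \<in> carrier M"
    and H: "subgroup H G" "openin T H"
    and smooth: "\<And>g. g \<in> H \<Longrightarrow>
      openin T {h \<in> carrier G. act M h (act M g y \<ominus>\<^bsub>M\<^esub> y) = act M g y \<ominus>\<^bsub>M\<^esub> y}"
    and x: "x \<in> carrier G"
  shows "\<exists>N>0. closed_hull {x [^] (N::nat)} \<subseteq> {g \<in> carrier G. act M g y = y}"
proof -
  interpret M: representation G K M by (rule rep)
  define \<delta> where "\<delta> = (\<lambda>g. act M g y \<ominus>\<^bsub>M\<^esub> y)"
  have \<delta>c: "\<delta> g \<in> carrier M" if "g \<in> carrier G" for g
    using that y M.act_closed unfolding \<delta>_def by simp
  have act\<delta>: "act M g y = y \<oplus>\<^bsub>M\<^esub> \<delta> g" if "g \<in> carrier G" for g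
    using that y M.act_closed[OF that y] unfolding \<delta>_def
    by (simp add: a_minus_def M.V.M.a_ac M.V.M.r_neg2)
  have stab: "subgroup {h \<in> carrier G. act M h (\<delta> g) = \<delta> g} G"
    "closedin T {h \<in> carrier G. act M h (\<delta> g) = \<delta> g}" if "g \<in> H" for g
  proof -
    show s: "subgroup {h \<in> carrier G. act M h (\<delta> g) = \<delta> g} G"
      using that subgroup.mem_carrier[OF H(1)] by (intro M.stabilizer_subgroup \<delta>c) blast
    show "closedin T {h \<in> carrier G. act M h (\<delta> g) = \<delta> g}"
      using smooth[OF that] by (intro open_subgroup_closed[OF s]) (simp add: \<delta>_def)
  qed
  have torsion: "[l] \<cdot>\<^bsub>M\<^esub> w = \<zero>\<^bsub>M\<^esub>" if "w \<in> carrier M" for w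
    using that l(2) by (simp add: M.add_pow_smult M.V.smult_l_null)
  have fix_pow: "act M (g [^] l) y = y" if "g \<in> carrier G" "act M g (\<delta> g) = \<delta> g" for g
    using M.act_pow_add[OF that(1) y \<delta>c[OF that(1)] act\<delta>[OF that(1)] that(2), of l]
      torsion[OF \<delta>c[OF that(1)]] y by simp
  obtain r1 where r1: "r1 > 0" "x [^] (r1::nat) \<in> H"
    using open_contains_pow[OF H(2) subgroup.one_closed[OF H(1)] x] by blast
  define x1 where "x1 = x [^] r1"
  have x1: "x1 \<in> H" "x1 \<in> carrier G" using r1 x by (auto simp: x1_def)
  have "openin T {h \<in> carrier G. act M h (\<delta> x1) = \<delta> x1}"
    using smooth[OF x1(1)] by (simp add: \<delta>_def)
  then obtain r where r: "r > 0" "x1 [^] (r::nat) \<in> {h \<in> carrier G. act M h (\<delta> x1) = \<delta> x1}"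
    using open_contains_pow subgroup.one_closed[OF stab(1)[OF x1(1)]] x1(2) by metis
  define z where "z = x1 [^] r"
  have z: "z \<in> carrier G" "act M z (\<delta> x1) = \<delta> x1" using r by (auto simp: z_def)
  \<comment> \<open>The equation \<open>x1 z y = z x1 y\<close>, expanded with \<open>z\<close> fixing \<open>\<delta> x1\<close>, shows that \<open>x1\<close> fixes \<open>\<delta> z\<close>.\<close>
  have "act M x1 (\<delta> z) = \<delta> z"
  proof -
    have comm: "x1 \<otimes> z = z \<otimes> x1" unfolding z_def using x1 by (simp add: nat_pow_Suc2[symmetric])
    have "y \<oplus>\<^bsub>M\<^esub> \<delta> z \<oplus>\<^bsub>M\<^esub> \<delta> x1 = act M z (act M x1 y)"
      using z y x1 \<delta>c by (simp add: act\<delta> M.act_add)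
    also have "\<dots> = act M x1 (act M z y)"
      using z(1) x1(2) y comm by (simp add: M.act_mult[symmetric])
    also have "\<dots> = y \<oplus>\<^bsub>M\<^esub> \<delta> x1 \<oplus>\<^bsub>M\<^esub> act M x1 (\<delta> z)"
      using z x1 y \<delta>c M.act_closed by (simp add: act\<delta> M.act_add)
    finally have "(y \<oplus>\<^bsub>M\<^esub> \<delta> x1) \<oplus>\<^bsub>M\<^esub> \<delta> z = (y \<oplus>\<^bsub>M\<^esub> \<delta> x1) \<oplus>\<^bsub>M\<^esub> act M x1 (\<delta> z)"
      using z x1 y \<delta>c M.act_closed by (simp add: M.V.M.a_ac)
    then show ?thesis
      using z x1 y \<delta>c M.act_closed by (simp add: M.V.M.add.Units_l_cancel M.V.M.add.Units_eq)
  qed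
  then have "x1 \<in> {g \<in> carrier G. act M g (\<delta> z) = \<delta> z}" using x1 by simp
  then have "z \<in> {g \<in> carrier G. act M g (\<delta> z) = \<delta> z}"
    unfolding z_def[symmetric] using subgroup_nat_pow_closed[OF M.stabilizer_subgroup[OF \<delta>c[OF z(1)]]]
    unfolding z_def by blast
  then have sy: "act M (z [^] l) y = y" using fix_pow z(1) by blast
  define s where "s = z [^] l"
  have s: "s \<in> carrier G" "act M s y = y" using sy z by (auto simp: s_def)
  have sH: "s \<in> H"
    unfolding s_def z_def using x1(1) subgroup_nat_pow_closed[OF H(1)] by blast
  have BH: "closed_hull {s} \<subseteq> H"
    using sH by (intro closed_hull_minimal H open_subgroup_closed) auto
  \<comment> \<open>Second torsion step: \<open>s\<close> fixes \<open>\<delta> b\<close> because \<open>s\<close> and \<open>b\<close> commute and \<open>s\<close> fixes \<open>y\<close>. The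
      stabilizer of \<open>\<delta> b\<close> is closed, so \<open>b\<close> fixes \<open>\<delta> b\<close> as well.\<close>
  have "act M (b [^] l) y = y" if b: "b \<in> closed_hull {s}" for b
  proof -
    have bH: "b \<in> H" and bc: "b \<in> carrier G" using b BH subgroup.mem_carrier[OF H(1)] by blast+
    have comm: "s \<otimes> b = b \<otimes> s"
      using closed_hull_singleton_commute[OF s(1) _ b, of s] closed_hull_incl[of "{s}"] by blast
    have "y \<oplus>\<^bsub>M\<^esub> act M s (\<delta> b) = act M s (act M b y)"
      using s bc y \<delta>c by (simp add: act\<delta>[OF bc] M.act_add)
    also have "\<dots> = act M b (act M s y)"
      using s(1) bc y comm by (simp add: M.act_mult[symmetric])
    also have "\<dots> = y \<oplus>\<^bsub>M\<^esub> \<delta> b" using s bc by (simp add: act\<delta>)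
    finally have "act M s (\<delta> b) = \<delta> b"
      using s bc y \<delta>c M.act_closed by (simp add: M.V.M.add.Units_l_cancel M.V.M.add.Units_eq)
    then have "closed_hull {s} \<subseteq> {h \<in> carrier G. act M h (\<delta> b) = \<delta> b}"
      using s(1) by (intro closed_hull_minimal stab[OF bH]) simp
    then show ?thesis using b bc fix_pow by blast
  qed
  moreover have "closed_hull {s [^] l} \<subseteq> (\<lambda>b. b [^] l) ` closed_hull {s}"
    by (rule closed_hull_pow_incl[OF s(1)])
  moreover have "closed_hull {s [^] l} \<subseteq> carrier G"
    using s(1) by (intro subgroup.subset[OF closed_hull_subgroup]) auto
  ultimately have "closed_hull {s [^] l} \<subseteq> {g \<in> carrier G. act M g y = y}" by blast
  moreover have "s [^] l = x [^] (r1 * r * l * l)"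
    unfolding s_def z_def x1_def using x by (simp add: nat_pow_pow mult.assoc)
  moreover have "r1 * r * l * l > 0" using r1 r l by simp
  ultimately show ?thesis by metis
qed

text \<open>There are finitely many generators, so one exponent serves them all.\<close>
lemma (in fg_powerful_pro_p) open_subgroup_stabilizes:
  fixes M :: "('k, 'v, 'a) repn" and l :: nat
  assumes rep: "representation G K M"
    and l: "l > 0" "[l] \<cdot>\<^bsub>K\<^esub> \<one>\<^bsub>K\<^esub> = \<zero>\<^bsub>K\<^esub>"
    and y: "y \<in> carrier M"
    and H: "subgroup H G" "openin T H"
    and smooth: "\<And>g. g \<in> H \<Longrightarrow>
      openin T {h \<in> carrier G. act M h (act M g y \<ominus>\<^bsub>M\<^esub> y) = act M g y \<ominus>\<^bsub>M\<^esub> y}"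
  shows "\<exists>N. subgroup N G \<and> openin T N \<and> closedin T N \<and> (\<forall>g\<in>N. act M g y = y)"
proof -
  interpret M: representation G K M by (rule rep)
  let ?S = "{g \<in> carrier G. act M g y = y}"
  have "\<forall>x\<in>set xs. \<exists>N>0. closed_hull {x [^] (N::nat)} \<subseteq> ?S"
    using procyclic_stabilizes[OF assms] gens_carrier by blast
  then obtain f where f: "\<And>x. x \<in> set xs \<Longrightarrow> f x > 0 \<and> closed_hull {x [^] (f x :: nat)} \<subseteq> ?S"
    by metis
  define N where "N = (\<Prod>x\<in>set xs. f x)"
  have N: "N > 0" unfolding N_def using f by (intro prod_pos) blast
  have "closed_hull {x [^] N} \<subseteq> ?S" if x: "x \<in> set xs" for x
  proof -
    have xc: "x \<in> carrier G" using gen_carrier[OF x] .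
    obtain m where m: "N = f x * m" using dvd_prodI[OF _ x, of f] unfolding N_def by auto
    have "x [^] f x \<in> closed_hull {x [^] f x}" using closed_hull_incl by blast
    moreover have sub: "subgroup (closed_hull {x [^] f x}) G"
      using xc by (intro closed_hull_subgroup) auto
    ultimately have "x [^] N \<in> closed_hull {x [^] f x}"
      using subgroup_nat_pow_closed[OF sub, of "x [^] f x" m] xc m by (simp add: nat_pow_pow)
    then have "closed_hull {x [^] N} \<subseteq> closed_hull {x [^] f x}"
      using xc by (intro closed_hull_minimal sub closed_hull_closed) auto
    then show ?thesis using f[OF x] by blast
  qed
  then obtain n where "F n \<subseteq> ?S"
    using subgroup_contains_F[OF M.stabilizer_subgroup[OF y] N] by blast
  then show ?thesis using F_subgroup F_open F_closed by blast
qed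

section \<open>Smooth vectors and the first derived functor\<close>

lemma rep_homD:
  assumes "f \<in> rep_hom G K V W"
  shows "v \<in> carrier V \<Longrightarrow> f v \<in> carrier W"
    and "v \<in> carrier V \<Longrightarrow> w \<in> carrier V \<Longrightarrow> f (v \<oplus>\<^bsub>V\<^esub> w) = f v \<oplus>\<^bsub>W\<^esub> f w"
    and "a \<in> carrier K \<Longrightarrow> v \<in> carrier V \<Longrightarrow> f (a \<odot>\<^bsub>V\<^esub> v) = a \<odot>\<^bsub>W\<^esub> f v"
    and "g \<in> carrier G \<Longrightarrow> v \<in> carrier V \<Longrightarrow> f (act V g v) = act W g (f v)"
  using assms by (auto simp: rep_hom_def)

lemma (in representation) minus_eq_smult:
  "v \<in> carrier V \<Longrightarrow> \<ominus>\<^bsub>V\<^esub> v = (\<ominus>\<^bsub>K\<^esub> \<one>\<^bsub>K\<^esub>) \<odot>\<^bsub>V\<^esub> v"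
  by (simp add: V.smult_l_minus V.smult_one)

lemma rep_hom_minus:
  assumes "representation G K V" "representation G K W" "f \<in> rep_hom G K V W" "v \<in> carrier V"
  shows "f (\<ominus>\<^bsub>V\<^esub> v) = \<ominus>\<^bsub>W\<^esub> f v"
proof -
  interpret V: representation G K V by fact
  interpret W: representation G K W by fact
  show ?thesis
    using assms(4) rep_homD[OF assms(3)] by (simp add: V.minus_eq_smult W.minus_eq_smult)
qed

lemma mem_smooth_part_iff:
  "x \<in> carrier (smooth_part G T V) \<longleftrightarrow> x \<in> carrier V \<and>
    (\<exists>H. subgroup H G \<and> compactin T H \<and> openin T H \<and> (\<forall>h\<in>H. act V h x = x))"
  by (auto simp: smooth_part_def fixed_vectors_def)

lemma smooth_part_zero [simp]: "\<zero>\<^bsub>smooth_part G T V\<^esub> = \<zero>\<^bsub>V\<^esub>"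
  by (simp add: smooth_part_def)

lemma (in topological_group) smooth_part_add:
  assumes "representation G K V"
    and x: "x \<in> carrier (smooth_part G T V)" and y: "y \<in> carrier (smooth_part G T V)"
  shows "x \<oplus>\<^bsub>V\<^esub> y \<in> carrier (smooth_part G T V)"
proof -
  interpret V: representation G K V by fact
  obtain A B where A: "subgroup A G" "compactin T A" "openin T A" "\<forall>h\<in>A. act V h x = x"
    and B: "subgroup B G" "compactin T B" "openin T B" "\<forall>h\<in>B. act V h y = y"
    using x y by (auto simp: mem_smooth_part_iff)
  have "subgroup (A \<inter> B) G" using A B by (intro subgroups_Inter_pair)
  moreover have "compactin T (A \<inter> B)"
    using closed_Int_compactin[OF open_subgroup_closed[OF A(1,3)] B(2)] .
  moreover have "openin T (A \<inter> B)" using A B by blast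
  moreover have "\<forall>h\<in>A \<inter> B. act V h (x \<oplus>\<^bsub>V\<^esub> y) = x \<oplus>\<^bsub>V\<^esub> y"
    using A B x y subgroup.mem_carrier[OF A(1)] by (auto simp: V.act_add mem_smooth_part_iff)
  ultimately show ?thesis using x y by (auto simp: mem_smooth_part_iff)
qed

lemma (in topological_group) smooth_part_minus:
  assumes "representation G K V" and x: "x \<in> carrier (smooth_part G T V)"
  shows "\<ominus>\<^bsub>V\<^esub> x \<in> carrier (smooth_part G T V)"
proof -
  interpret V: representation G K V by fact
  obtain A where A: "subgroup A G" "compactin T A" "openin T A" "\<forall>h\<in>A. act V h x = x"
    using x by (auto simp: mem_smooth_part_iff)
  have xc: "x \<in> carrier V" using x by (simp add: mem_smooth_part_iff)
  have "\<forall>h\<in>A. act V h (\<ominus>\<^bsub>V\<^esub> x) = \<ominus>\<^bsub>V\<^esub> x"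
    using A(4) xc subgroup.mem_carrier[OF A(1)] by (simp add: V.minus_eq_smult V.act_smult)
  then show ?thesis using A xc by (auto simp: mem_smooth_part_iff)
qed

text \<open>The orbit map of \<open>v\<close> is continuous for the discrete topology, and the stabilizer is the preimage of the
  point \<open>v\<close>.\<close>
lemma (in topological_group) open_stabilizer_of_smooth:
  assumes V: "smooth_representation G T K V" and v: "v \<in> carrier V"
  shows "openin T {g \<in> carrier G. act V g v = v}"
proof -
  have "continuous_map T (prod_topology T (discrete_topology (carrier V))) (\<lambda>g. (g, v))"
    using v by (intro continuous_map_pairedI) auto
  then have "continuous_map T (discrete_topology (carrier V)) (\<lambda>g. act V g v)"
    using V continuous_map_compose unfolding smooth_representation_def
    by (fastforce simp: o_def)
  from openin_continuous_map_preimage[OF this, of "{v}"]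
  show ?thesis using v by (simp add: topspace_eq)
qed

text \<open>The heart of the matter: a vector whose abstract cocycle has smooth values is itself smooth. The
  open subgroup that fixes it is a term of the lower \<open>p\<close>-series of a powerful open subgroup \<open>U\<close>; it is compact
  because it is closed in \<open>U\<close>.\<close>
lemma (in topological_group) smooth_of_smooth_differences:
  fixes M :: "('k, 'v, 'g) repn" and l :: nat
  assumes p: "Factorial_Ring.prime p" and analytic: "p_adic_analytic_group p G T"
    and rep: "representation G K M"
    and l: "l > 0" "[l] \<cdot>\<^bsub>K\<^esub> \<one>\<^bsub>K\<^esub> = \<zero>\<^bsub>K\<^esub>"
    and y: "y \<in> carrier M"
    and H: "subgroup H G" "openin T H"
    and smooth: "\<And>g. g \<in> H \<Longrightarrow>
      openin T {h \<in> carrier G. act M h (act M g y \<ominus>\<^bsub>M\<^esub> y) = act M g y \<ominus>\<^bsub>M\<^esub> y}"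
  shows "y \<in> carrier (smooth_part G T M)"
proof -
  interpret M: representation G K M by (rule rep)
  obtain U where U: "subgroup U G" "openin T U"
    and pow: "powerful_pro_p_group p (G\<lparr>carrier := U\<rparr>) (subtopology T U)"
    and fg: "topologically_finitely_generated (G\<lparr>carrier := U\<rparr>) (subtopology T U)"
    using analytic unfolding p_adic_analytic_group_def by blast
  let ?G = "G\<lparr>carrier := U\<rparr>" and ?T = "subtopology T U"
  obtain X where X: "finite X" "X \<subseteq> carrier ?G" "?T closure_of (generate ?G X) = carrier ?G"
    using fg unfolding topologically_finitely_generated_def by blast
  obtain xs where xs: "set xs = X" using finite_list[OF X(1)] by blast
  interpret U: fg_powerful_pro_p ?G ?T p xs
    using pow p X xs
    unfolding powerful_pro_p_group_def pro_p_group_def profinite_group_def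
    by (intro fg_powerful_pro_p.intro powerful_pro_p.intro pro_p.intro compact_group.intro
        pro_p_axioms.intro compact_group_axioms.intro powerful_pro_p_axioms.intro
        fg_powerful_pro_p_axioms.intro) blast+
  have Uc: "U \<subseteq> carrier G" using subgroup.subset[OF U(1)] .
  have "\<exists>N. subgroup N ?G \<and> openin ?T N \<and> closedin ?T N \<and> (\<forall>g\<in>N. act M g y = y)"
  proof (rule U.open_subgroup_stabilizes[OF M.restrict_to_subgroup[OF U(1)] l y])
    show "subgroup (H \<inter> U) ?G"
      using subgroups_Inter_pair[OF H(1) U(1)] by (intro subgroup_incl U) auto
    show "openin ?T (H \<inter> U)" using H(2) by (rule openin_subtopology_Int)
    fix g assume "g \<in> H \<inter> U"
    then have "openin ?T ({h \<in> carrier G. act M h (act M g y \<ominus>\<^bsub>M\<^esub> y) = act M g y \<ominus>\<^bsub>M\<^esub> y} \<inter> U)"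
      using smooth by (intro openin_subtopology_Int) blast
    moreover have "{h \<in> carrier G. act M h (act M g y \<ominus>\<^bsub>M\<^esub> y) = act M g y \<ominus>\<^bsub>M\<^esub> y} \<inter> U
        = {h \<in> carrier ?G. act M h (act M g y \<ominus>\<^bsub>M\<^esub> y) = act M g y \<ominus>\<^bsub>M\<^esub> y}"
      using Uc by auto
    ultimately show "openin ?T {h \<in> carrier ?G. act M h (act M g y \<ominus>\<^bsub>M\<^esub> y) = act M g y \<ominus>\<^bsub>M\<^esub> y}"
      by simp
  qed
  then obtain N where N: "subgroup N ?G" "openin ?T N" "closedin ?T N" "\<forall>g\<in>N. act M g y = y"
    by blast
  have "subgroup N G" using incl_subgroup[OF U(1) N(1)] .
  moreover have "openin T N" using openin_trans_full[OF N(2) U(2)] .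
  moreover have "compactin T N"
    using closedin_compact_space[OF U.compact N(3)] by (simp add: compactin_subtopology)
  ultimately show ?thesis using N(4) y by (auto simp: mem_smooth_part_iff)
qed

text \<open>The carrier of the cohomology consists of the translates of the coboundaries by cocycles. When the two sets
  agree and are closed under translation, there is only one.\<close>
lemma cohomology_trivialI:
  fixes C :: "nat \<Rightarrow> ('k, 'v, 'g) repn"
  assumes eq: "cocycles C d n = coboundaries C d n"
    and zero: "z \<in> cocycles C d n"
    and absorb: "\<And>a. a \<in> cocycles C d n \<Longrightarrow> (\<lambda>b. b \<oplus>\<^bsub>C n\<^esub> a) ` cocycles C d n = cocycles C d n"
  shows "carrier (cohomology C d n) = {\<zero>\<^bsub>cohomology C d n\<^esub>}"
proof -
  have "carrier (cohomology C d n) = (\<lambda>a. (\<lambda>b. b \<oplus>\<^bsub>C n\<^esub> a) ` cocycles C d n) ` cocycles C d n"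
    unfolding cohomology_def quotient_rep_def eq[symmetric]
    by (auto simp: A_RCOSETS_def RCOSETS_def r_coset_def image_def)
  also have "\<dots> = {cocycles C d n}" using absorb zero by auto
  finally show ?thesis by (simp add: cohomology_def quotient_rep_def eq)
qed

theorem theorem4:
  fixes G :: "'g monoid" and T :: "'g topology" and K :: "'k ring" and p :: nat
    and V :: "('k, 'v, 'g) repn"
    and \<epsilon> :: "'v \<Rightarrow> 'i" and I :: "nat \<Rightarrow> ('k, 'i, 'g) repn" and d :: "nat \<Rightarrow> 'i \<Rightarrow> 'i"
  assumes "field K" and "\<exists>n::nat. n > 0 \<and> [n] \<cdot>\<^bsub>K\<^esub> \<one>\<^bsub>K\<^esub> = \<zero>\<^bsub>K\<^esub>"
    and "Factorial_Ring.prime p"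
    and "p_adic_analytic_group p G T"
    and "smooth_representation G T K V"
    and "injective_resolution G K V \<epsilon> I d"
  shows "carrier (derived_smooth_part G T I d 1) = {\<zero>\<^bsub>derived_smooth_part G T I d 1\<^esub>}"
proof -
  have "topological_group G T" using assms(4) by (simp add: p_adic_analytic_group_def)
  then interpret topological_group G T .
  obtain l :: nat where l: "l > 0" "[l] \<cdot>\<^bsub>K\<^esub> \<one>\<^bsub>K\<^esub> = \<zero>\<^bsub>K\<^esub>" using assms(2) by blast
  note res = assms(6)[unfolded injective_resolution_def]
  have repI: "representation G K (I n)" for n
    using res by (simp add: injective_rep_def)
  have \<epsilon>: "\<epsilon> \<in> rep_hom G K V (I 0)" "inj_on \<epsilon> (carrier V)"
    "\<epsilon> ` carrier V = {x \<in> carrier (I 0). d 0 x = \<zero>\<^bsub>I 1\<^esub>}"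
    and d: "\<And>n. d n \<in> rep_hom G K (I n) (I (Suc n))"
    and exact: "\<And>n. d n ` carrier (I n) = {x \<in> carrier (I (Suc n)). d (Suc n) x = \<zero>\<^bsub>I (Suc (Suc n))\<^esub>}"
    using res by blast+
  interpret V: representation G K V using res by blast
  interpret I0: representation G K "I 0" by (rule repI)
  interpret I1: representation G K "I 1" by (rule repI)
  interpret I2: representation G K "I 2" by (rule repI)
  define C where "C = (\<lambda>m. smooth_part G T (I m))"
  have d0: "d 0 \<in> rep_hom G K (I 0) (I 1)" and d1: "d 1 \<in> rep_hom G K (I 1) (I 2)"
    using d[of 0] d[of 1] by (simp_all add: numeral_2_eq_2)
  have Z: "cocycles C d 1 = {x \<in> carrier (smooth_part G T (I 1)). d 1 x = \<zero>\<^bsub>I 2\<^esub>}"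
    by (simp add: cocycles_def C_def numeral_2_eq_2)
  have B: "coboundaries C d 1 = d 0 ` carrier (smooth_part G T (I 0))"
    by (simp add: coboundaries_def C_def)
  have stab_\<epsilon>: "openin T {h \<in> carrier G. act (I 0) h w = w}" if "w \<in> \<epsilon> ` carrier V" for w
  proof -
    from that obtain v where w: "w = \<epsilon> v" and v: "v \<in> carrier V" by (rule imageE)
    have "act (I 0) h w = w \<longleftrightarrow> act V h v = v" if "h \<in> carrier G" for h
      unfolding w rep_homD(4)[OF \<epsilon>(1) that v, symmetric]
      by (rule inj_on_eq_iff[OF \<epsilon>(2) V.act_closed[OF that v] v])
    then have "{h \<in> carrier G. act (I 0) h w = w} = {h \<in> carrier G. act V h v = v}"
      by (intro Collect_cong conj_cong refl)
    then show ?thesis using open_stabilizer_of_smooth[OF assms(5) v] by (simp only:)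
  qed
  have BZ: "coboundaries C d 1 \<subseteq> cocycles C d 1"
  proof
    fix x assume "x \<in> coboundaries C d 1"
    then obtain y where y: "y \<in> carrier (smooth_part G T (I 0))" "x = d 0 y" unfolding B by blast
    obtain A where A: "subgroup A G" "compactin T A" "openin T A" "\<forall>h\<in>A. act (I 0) h y = y"
      and yc: "y \<in> carrier (I 0)"
      using y(1) by (auto simp: mem_smooth_part_iff)
    have "\<forall>h\<in>A. act (I 1) h x = x"
      unfolding y(2) using A(4) rep_homD(4)[OF d0 _ yc] subgroup.mem_carrier[OF A(1)] by metis
    moreover have "x \<in> carrier (I 1)" "d 1 x = \<zero>\<^bsub>I 2\<^esub>"
      using exact[of 0] yc y(2) by (auto simp: numeral_2_eq_2)
    ultimately show "x \<in> cocycles C d 1"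
      using A unfolding Z by (auto simp: mem_smooth_part_iff)
  qed
  have ZB: "cocycles C d 1 \<subseteq> coboundaries C d 1"
  proof
    fix x assume "x \<in> cocycles C d 1"
    then have xc: "x \<in> carrier (I 1)" and "d 1 x = \<zero>\<^bsub>I 2\<^esub>"
      and "x \<in> carrier (smooth_part G T (I 1))"
      unfolding Z by (auto simp: mem_smooth_part_iff)
    then obtain H where H: "subgroup H G" "openin T H" "\<forall>h\<in>H. act (I 1) h x = x"
      by (auto simp: mem_smooth_part_iff)
    have "x \<in> d 0 ` carrier (I 0)"
      using exact[of 0] xc \<open>d 1 x = \<zero>\<^bsub>I 2\<^esub>\<close> by (simp add: numeral_2_eq_2)
    then obtain y where y: "y \<in> carrier (I 0)" "x = d 0 y" by blast
    have "y \<in> carrier (smooth_part G T (I 0))"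
    proof (rule smooth_of_smooth_differences[OF assms(3,4) repI l y(1) H(1,2)])
      fix g assume g: "g \<in> H"
      have gc: "g \<in> carrier G" using g subgroup.mem_carrier[OF H(1)] by blast
      have gy: "act (I 0) g y \<in> carrier (I 0)" using gc y(1) by (rule I0.act_closed)
      have "d 0 (act (I 0) g y \<ominus>\<^bsub>I 0\<^esub> y) = act (I 1) g x \<oplus>\<^bsub>I 1\<^esub> (\<ominus>\<^bsub>I 1\<^esub> x)"
        using rep_homD[OF d0] rep_hom_minus[OF repI repI d0 y(1)] gc gy y
        by (simp add: a_minus_def)
      also have "\<dots> = \<zero>\<^bsub>I 1\<^esub>" using H(3) g xc by (simp add: I1.V.M.r_neg del: One_nat_def)
      finally have "act (I 0) g y \<ominus>\<^bsub>I 0\<^esub> y \<in> \<epsilon> ` carrier V"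
        unfolding \<epsilon>(3) using gy y(1) by simp
      then show "openin T {h \<in> carrier G. act (I 0) h (act (I 0) g y \<ominus>\<^bsub>I 0\<^esub> y)
          = act (I 0) g y \<ominus>\<^bsub>I 0\<^esub> y}"
        by (rule stab_\<epsilon>)
    qed
    then show "x \<in> coboundaries C d 1" unfolding B using y(2) by blast
  qed
  have addZ: "a \<oplus>\<^bsub>I 1\<^esub> b \<in> cocycles C d 1" if "a \<in> cocycles C d 1" "b \<in> cocycles C d 1" for a b
    using that smooth_part_add[OF repI, of a 1 b] rep_homD(2)[OF d1, of a b] unfolding Z
    by (simp add: mem_smooth_part_iff)
  have minusZ: "\<ominus>\<^bsub>I 1\<^esub> a \<in> cocycles C d 1" if "a \<in> cocycles C d 1" for a
    using that smooth_part_minus[OF repI, of a 1] rep_hom_minus[OF repI repI d1, of a] unfolding Z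
    by (simp add: mem_smooth_part_iff)
  have Zc: "a \<in> carrier (I 1)" if "a \<in> cocycles C d 1" for a
    using that unfolding Z by (simp add: mem_smooth_part_iff)
  show ?thesis
    unfolding derived_smooth_part_def C_def[symmetric]
  proof (rule cohomology_trivialI)
    show "cocycles C d 1 = coboundaries C d 1" using BZ ZB by blast
    have zero: "act (I 0) g \<zero>\<^bsub>I 0\<^esub> = \<zero>\<^bsub>I 0\<^esub>" if "g \<in> carrier G" for g
      using I0.act_smult[of g "\<zero>\<^bsub>K\<^esub>" "\<zero>\<^bsub>I 0\<^esub>"] I0.act_closed[of g "\<zero>\<^bsub>I 0\<^esub>"] that
      by (simp add: I0.V.smult_l_null)
    \<comment> \<open>Smoothness of the zero vector means that compact open subgroups exist; it is another instance of
      \<open>smooth_of_smooth_differences\<close>.\<close>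
    then have "{g \<in> carrier G. act (I 0) g \<zero>\<^bsub>I 0\<^esub> = \<zero>\<^bsub>I 0\<^esub>} = carrier G" by blast
    with zero have "\<zero>\<^bsub>I 0\<^esub> \<in> carrier (smooth_part G T (I 0))"
      using openin_topspace[of T]
      by (intro smooth_of_smooth_differences[OF assms(3,4) repI l _ subgroup_self])
        (simp_all add: topspace_eq I0.V.M.r_neg a_minus_def)
    then show "d 0 \<zero>\<^bsub>I 0\<^esub> \<in> cocycles C d 1" using BZ unfolding B by blast
    fix a assume a: "a \<in> cocycles C d 1"
    have "b \<in> (\<lambda>b. b \<oplus>\<^bsub>I 1\<^esub> a) ` cocycles C d 1" if b: "b \<in> cocycles C d 1" for b
    proof (rule image_eqI)
      show "b \<oplus>\<^bsub>I 1\<^esub> (\<ominus>\<^bsub>I 1\<^esub> a) \<in> cocycles C d 1" using addZ minusZ a b by blast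
      show "b = b \<oplus>\<^bsub>I 1\<^esub> (\<ominus>\<^bsub>I 1\<^esub> a) \<oplus>\<^bsub>I 1\<^esub> a"
        using Zc[OF a] Zc[OF b] by (simp add: I1.V.M.a_assoc I1.V.M.l_neg del: One_nat_def)
    qed
    then show "(\<lambda>b. b \<oplus>\<^bsub>C 1\<^esub> a) ` cocycles C d 1 = cocycles C d 1"
      using addZ a by (auto simp: C_def smooth_part_def)
  qed
qed

end
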